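(* Let $m\geq 3$ be odd, $G_m$ the dihedral group of order $2m$, $\tau\in\mathbb{C}$, and let $(\Lambda,M,C,* )$ be a cellular structure on $\mathbb{C}G_m$ whose anti-involution $*$ is the linear extension of $w\mapsto w^{-1}$. Define $(\bar\Lambda,\bar M,\bar C,* )$ as follows. - $\bar\Lambda=\Lambda\amalg\{\lambda_{Kr}\}$, keeping the partial order of $\Lambda$ and setting $\lambda_{Kr}\prec\lambda$ for every $\lambda\in\Lambda$. - $\bar M(\lambda)=M(\lambda)$ for $\lambda\in\Lambda$, and $\bar M(\lambda_{Kr})=\{0,1,\dots,m-1\}$. - $\bar C^\lambda_{S,T}=C^\lambda_{S,T}$ (via $\mathbb{C}G_m\subset B_{G_m}(\Upsilon)$) for $\lambda\in\Lambda$, $S,T\in M(\lambda)$; and $\bar C^{\lambda_{Kr}}_{i,j}=we_j$ for any $w\in G_m$ with $ws_jw^{-1}=s_i$ (this does not depend on the choice of $w$). - $*$ is the $\mathbb{C}$-linear anti-involution of $B_{G_m}(\Upsilon)$ with $w\mapsto w^{-1}$ for $w\in G_m$ and $e_i\mapsto e_i$ for all $i$. Then $(\bar\Lambda,\bar M,\bar C,* )$ is a cellular structure for $B_{G_m}(\Upsilon)$.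
   Context: $G_m=\langle s_0,s_1\mid s_0^2=s_1^2=(s_0s_1)^m=1\rangle$ with reflections $s_0,\dots,s_{m-1}$, where $s_i=s_{i-1}s_{i-2}s_{i-1}$ for $i\ge2$. For $m$ odd and $i\ne j$ there is a unique $k(i,j)\in\{0,\dots,m-1\}$ with $s_{k(i,j)}s_js_{k(i,j)}=s_i$. The parameters $\Upsilon$ are given by one number $\tau$ (with the parameter $\mu$ normalized to $1$). $B_{G_m}(\Upsilon)$ is the unital $\mathbb{C}$-algebra generated by $s_0,s_1,e_0,\dots,e_{m-1}$ with relations: (1) $s_0^2=s_1^2=1$; (2) $(s_0s_1)^m=1$; (3) $s_ie_i=e_is_i=e_i$ for $0\le i\le m-1$; (4) $we_i=e_jw$ for every $w\in G_m$ with $ws_i=s_jw$; (5) $e_i^2=\tau e_i$; (6) $e_ie_j=s_{k(i,j)}e_j=e_is_{k(i,j)}$ for $i\ne j$. It contains $\mathbb{C}G_m$. Cellular structure (Graham–Lehrer) on a $\mathbb{C}$-algebra $A$: data $(\Lambda,M,C,* )$ where (C1) $\Lambda$ is a partially ordered set, each $M(\lambda)$ is a finite set, and $C:\coprod_{\lambda}M(\lambda)\times M(\lambda)\to A$, $(S,T)\mapsto C^\lambda_{S,T}$, is injective with image a basis of $A$; (C2) $*$ is a linear anti-involution with $*(C^\lambda_{S,T})=C^\lambda_{T,S}$; (C3) for $a\in A$, $aC^\lambda_{S,T}\equiv\sum_{S'\in M(\lambda)}r_a(S',S)C^\lambda_{S',T}$ modulo $A(<\lambda)$, with $r_a(S',S)\in\mathbb{C}$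 independent of $T$ and $A(<\lambda)$ the span of all $C^\mu_{S'',T''}$ with $\mu<\lambda$. *)

theory Defs
  imports "HOL-Algebra.Module" "HOL-Algebra.QuotRing" Complex_Main
begin

section \<open>Associative complex algebras and cellular structures\<close>

definition complex_ring :: "complex ring" where
  "complex_ring = \<lparr>carrier = UNIV, mult = (*), one = 1, zero = 0, add = (+)\<rparr>"

text \<open>The locale \<open>algebra\<close> of HOL-Algebra requires a commutative ring, which is too restrictive here.\<close>

locale complex_algebra =
  Module.module complex_ring A + ring A
  for A :: "(complex, 'a) module" (structure) +
  assumes smult_mult_left:
      "\<lbrakk>x \<in> carrier A; y \<in> carrier A\<rbrakk> \<Longrightarrow> (c \<odot> x) \<otimes> y = c \<odot> (x \<otimes> y)"
    and smult_mult_right: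
      "\<lbrakk>x \<in> carrier A; y \<in> carrier A\<rbrakk> \<Longrightarrow> x \<otimes> (c \<odot> y) = c \<odot> (x \<otimes> y)"

definition lin_span :: "(complex, 'a) module \<Rightarrow> 'a set \<Rightarrow> 'a set" where
  "lin_span A X = {finsum A (\<lambda>b. c b \<odot>\<^bsub>A\<^esub> b) F | F c. finite F \<and> F \<subseteq> X}"

definition lin_independent :: "(complex, 'a) module \<Rightarrow> 'a set \<Rightarrow> bool" where
  "lin_independent A X \<longleftrightarrow>
     (\<forall>F c. finite F \<and> F \<subseteq> X \<and> finsum A (\<lambda>b. c b \<odot>\<^bsub>A\<^esub> b) F = \<zero>\<^bsub>A\<^esub> \<longrightarrow> (\<forall>b\<in>F. c b = 0))"

definition lin_basis :: "(complex, 'a) module \<Rightarrow> 'a set \<Rightarrow> bool" where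
  "lin_basis A X \<longleftrightarrow> X \<subseteq> carrier A \<and> lin_independent A X \<and> lin_span A X = carrier A"

definition linear_anti_involution :: "(complex, 'a) module \<Rightarrow> ('a \<Rightarrow> 'a) \<Rightarrow> bool" where
  "linear_anti_involution A star \<longleftrightarrow>
     star \<in> carrier A \<rightarrow> carrier A \<and>
     (\<forall>x\<in>carrier A. \<forall>y\<in>carrier A. star (x \<oplus>\<^bsub>A\<^esub> y) = star x \<oplus>\<^bsub>A\<^esub> star y) \<and>
     (\<forall>c. \<forall>x\<in>carrier A. star (c \<odot>\<^bsub>A\<^esub> x) = c \<odot>\<^bsub>A\<^esub> star x) \<and>
     (\<forall>x\<in>carrier A. \<forall>y\<in>carrier A. star (x \<otimes>\<^bsub>A\<^esub> y) = star y \<otimes>\<^bsub>A\<^esub> star x) \<and>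
     (\<forall>x\<in>carrier A. star (star x) = x)"

text \<open>\<open>cell_lower \<dots> \<lambda>\<close> is \<open>A(<\<lambda>)\<close>; the partial order is given by its reflexive relation \<open>po\<close>.\<close>

definition cell_lower :: "(complex, 'a) module \<Rightarrow> 'l set \<Rightarrow> ('l \<times> 'l) set
    \<Rightarrow> ('l \<Rightarrow> 's set) \<Rightarrow> ('l \<Rightarrow> 's \<Rightarrow> 's \<Rightarrow> 'a) \<Rightarrow> 'l \<Rightarrow> 'a set" where
  "cell_lower A \<Lambda> po M C l = lin_span A
     {C k S T | k S T. k \<in> \<Lambda> \<and> (k, l) \<in> po \<and> k \<noteq> l \<and> S \<in> M k \<and> T \<in> M k}"

locale cellular_structure = complex_algebra A
  for A :: "(complex, 'a) module" (structure) +
  fixes \<Lambda> :: "'l set" and po :: "('l \<times> 'l) set"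
    and M :: "'l \<Rightarrow> 's set" and C :: "'l \<Rightarrow> 's \<Rightarrow> 's \<Rightarrow> 'a" and star :: "'a \<Rightarrow> 'a"
  assumes order: "partial_order_on \<Lambda> po"
    and finite_M: "l \<in> \<Lambda> \<Longrightarrow> finite (M l)"
    and C_inj: "inj_on (\<lambda>(l, S, T). C l S T) (SIGMA l:\<Lambda>. M l \<times> M l)"
    and C_basis: "lin_basis A ((\<lambda>(l, S, T). C l S T) ` (SIGMA l:\<Lambda>. M l \<times> M l))"
    and star_anti_involution: "linear_anti_involution A star"
    and star_C: "\<lbrakk>l \<in> \<Lambda>; S \<in> M l; T \<in> M l\<rbrakk> \<Longrightarrow> star (C l S T) = C l T S"
    and mult_C: "\<lbrakk>a \<in> carrier A; l \<in> \<Lambda>\<rbrakk> \<Longrightarrow>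
      \<exists>r :: 's \<Rightarrow> 's \<Rightarrow> complex. \<forall>S\<in>M l. \<forall>T\<in>M l.
        a \<otimes> C l S T \<ominus> (\<Oplus>S'\<in>M l. r S' S \<odot> C l S' T) \<in> cell_lower A \<Lambda> po M C l"


section \<open>Monoid algebras, presented groups and presented algebras\<close>

definition monoid_algebra :: "'g monoid \<Rightarrow> (complex, 'g \<Rightarrow> complex) module" where
  "monoid_algebra G =
    \<lparr>carrier = {f. finite {x. f x \<noteq> 0} \<and> {x. f x \<noteq> 0} \<subseteq> carrier G},
     mult = (\<lambda>f g x. \<Sum>(y, z)\<in>{(y, z). f y \<noteq> 0 \<and> g z \<noteq> 0 \<and> y \<otimes>\<^bsub>G\<^esub> z = x}. f y * g z),
     one = (\<lambda>_. 0)(\<one>\<^bsub>G\<^esub> := 1),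
     zero = (\<lambda>_. 0),
     add = (\<lambda>f g x. f x + g x),
     smult = (\<lambda>c f x. c * f x)\<rparr>"

definition free_monoid :: "'g set \<Rightarrow> 'g list monoid" where
  "free_monoid X = \<lparr>carrier = lists X, mult = (@), one = []\<rparr>"

abbreviation free_algebra :: "'g set \<Rightarrow> (complex, 'g list \<Rightarrow> complex) module" where
  "free_algebra X \<equiv> monoid_algebra (free_monoid X)"

definition monomial :: "complex \<Rightarrow> 'g list \<Rightarrow> 'g list \<Rightarrow> complex" where
  "monomial c u = (\<lambda>_. 0)(u := c)"

definition relation_ideal ::
    "'g set \<Rightarrow> (('g list \<Rightarrow> complex) \<times> ('g list \<Rightarrow> complex)) set \<Rightarrow> ('g list \<Rightarrow> complex) set" where
  "relation_ideal X R = Idl\<^bsub>free_algebra X\<^esub> {p \<ominus>\<^bsub>free_algebra X\<^esub> q | p q. (p, q) \<in> R}"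

definition presented_algebra ::
    "'g set \<Rightarrow> (('g list \<Rightarrow> complex) \<times> ('g list \<Rightarrow> complex)) set
      \<Rightarrow> (complex, ('g list \<Rightarrow> complex) set) module" where
  "presented_algebra X R =
    ring.extend (free_algebra X Quot relation_ideal X R)
      (module.fields
        (\<lambda>c P. \<Union>p\<in>P. relation_ideal X R +>\<^bsub>free_algebra X\<^esub> (c \<odot>\<^bsub>free_algebra X\<^esub> p)))"

inductive word_cong :: "('g list \<times> 'g list) set \<Rightarrow> 'g list \<Rightarrow> 'g list \<Rightarrow> bool" for R where
  relation: "(u, v) \<in> R \<Longrightarrow> word_cong R u v"
| reflexive: "word_cong R u u"
| symmetric: "word_cong R u v \<Longrightarrow> word_cong R v u"
| transitive: "word_cong R u v \<Longrightarrow> word_cong R v w \<Longrightarrow> word_cong R u w"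
| append: "word_cong R u u' \<Longrightarrow> word_cong R v v' \<Longrightarrow> word_cong R (u @ v) (u' @ v')"

definition presented_monoid :: "('g list \<times> 'g list) set \<Rightarrow> 'g list set monoid" where
  "presented_monoid R =
    \<lparr>carrier = range (\<lambda>u. Collect (word_cong R u)),
     mult = (\<lambda>U V. {w. \<exists>u\<in>U. \<exists>v\<in>V. word_cong R (u @ v) w}),
     one = Collect (word_cong R [])\<rparr>"


section \<open>The dihedral group\<close>

datatype sgen = S0 | S1

definition dihedral_relations :: "nat \<Rightarrow> (sgen list \<times> sgen list) set" where
  "dihedral_relations m =
     {([S0, S0], []), ([S1, S1], []), (concat (replicate m [S0, S1]), [])}"

text \<open>As both generators are involutions by the relations, the monoid with this
  presentation is the group with this presentation.\<close>

definition dihedral :: "nat \<Rightarrow> sgen list set monoid" where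
  "dihedral m = presented_monoid (dihedral_relations m)"

definition word_class :: "nat \<Rightarrow> sgen list \<Rightarrow> sgen list set" where
  "word_class m u = Collect (word_cong (dihedral_relations m) u)"

fun reflection_word :: "nat \<Rightarrow> sgen list" where
  "reflection_word 0 = [S0]"
| "reflection_word (Suc 0) = [S1]"
| "reflection_word (Suc (Suc i)) =
     reflection_word (Suc i) @ reflection_word i @ reflection_word (Suc i)"

definition reflection :: "nat \<Rightarrow> nat \<Rightarrow> sgen list set" where
  "reflection m i = word_class m (reflection_word i)"

definition conj_index :: "nat \<Rightarrow> nat \<Rightarrow> nat \<Rightarrow> nat" where
  "conj_index m i j = (THE k. k < m \<and>
     reflection m k \<otimes>\<^bsub>dihedral m\<^esub> reflection m j \<otimes>\<^bsub>dihedral m\<^esub> reflection m k = reflection m i)"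

abbreviation group_algebra :: "nat \<Rightarrow> (complex, sgen list set \<Rightarrow> complex) module" where
  "group_algebra m \<equiv> monoid_algebra (dihedral m)"

text \<open>The linear extension of \<open>w \<mapsto> w\<inverse>\<close>.\<close>

definition inversion :: "nat \<Rightarrow> (sgen list set \<Rightarrow> complex) \<Rightarrow> sgen list set \<Rightarrow> complex" where
  "inversion m f = (\<lambda>w. if w \<in> carrier (dihedral m) then f (inv\<^bsub>dihedral m\<^esub> w) else 0)"


section \<open>The Brauer algebra of the dihedral group\<close>

datatype bgen = Refl sgen | E nat

abbreviation (input) gword :: "sgen list \<Rightarrow> bgen list" where
  "gword u \<equiv> map Refl u"

abbreviation (input) sword :: "nat \<Rightarrow> bgen list" where
  "sword i \<equiv> map Refl (reflection_word i)"

text \<open>In \<open>transport\<close>, the word \<open>u\<close> represents the group element \<open>w\<close>.\<close>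

inductive_set brauer_relations ::
    "nat \<Rightarrow> complex \<Rightarrow> ((bgen list \<Rightarrow> complex) \<times> (bgen list \<Rightarrow> complex)) set"
  for m :: nat and \<tau> :: complex where
  s0_square: "(monomial 1 [Refl S0, Refl S0], monomial 1 []) \<in> brauer_relations m \<tau>"
| s1_square: "(monomial 1 [Refl S1, Refl S1], monomial 1 []) \<in> brauer_relations m \<tau>"
| braid: "(monomial 1 (concat (replicate m [Refl S0, Refl S1])), monomial 1 []) \<in> brauer_relations m \<tau>"
| s_e: "i < m \<Longrightarrow> (monomial 1 (sword i @ [E i]), monomial 1 [E i]) \<in> brauer_relations m \<tau>"
| e_s: "i < m \<Longrightarrow> (monomial 1 ([E i] @ sword i), monomial 1 [E i]) \<in> brauer_relations m \<tau>"
| transport: "\<lbrakk>i < m; j < m;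
      word_class m u \<otimes>\<^bsub>dihedral m\<^esub> reflection m i = reflection m j \<otimes>\<^bsub>dihedral m\<^esub> word_class m u\<rbrakk>
    \<Longrightarrow> (monomial 1 (gword u @ [E i]), monomial 1 ([E j] @ gword u)) \<in> brauer_relations m \<tau>"
| e_square: "i < m \<Longrightarrow> (monomial 1 [E i, E i], monomial \<tau> [E i]) \<in> brauer_relations m \<tau>"
| e_e_left: "\<lbrakk>i < m; j < m; i \<noteq> j\<rbrakk>
    \<Longrightarrow> (monomial 1 [E i, E j], monomial 1 (sword (conj_index m i j) @ [E j])) \<in> brauer_relations m \<tau>"
| e_e_right: "\<lbrakk>i < m; j < m; i \<noteq> j\<rbrakk>
    \<Longrightarrow> (monomial 1 [E i, E j], monomial 1 ([E i] @ sword (conj_index m i j))) \<in> brauer_relations m \<tau>"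

definition brauer_gens :: "nat \<Rightarrow> bgen set" where
  "brauer_gens m = range Refl \<union> E ` {..<m}"

definition brauer_algebra :: "nat \<Rightarrow> complex \<Rightarrow> (complex, (bgen list \<Rightarrow> complex) set) module" where
  "brauer_algebra m \<tau> = presented_algebra (brauer_gens m) (brauer_relations m \<tau>)"

definition brauer_word :: "nat \<Rightarrow> complex \<Rightarrow> bgen list \<Rightarrow> (bgen list \<Rightarrow> complex) set" where
  "brauer_word m \<tau> u =
     relation_ideal (brauer_gens m) (brauer_relations m \<tau>)
       +>\<^bsub>free_algebra (brauer_gens m)\<^esub> monomial 1 u"

definition brauer_e :: "nat \<Rightarrow> complex \<Rightarrow> nat \<Rightarrow> (bgen list \<Rightarrow> complex) set" where
  "brauer_e m \<tau> i = brauer_word m \<tau> [E i]"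

text \<open>All words representing \<open>w\<close> have the same image in the Brauer algebra,
  which is the image of \<open>w\<close>.\<close>

definition brauer_of_group ::
    "nat \<Rightarrow> complex \<Rightarrow> sgen list set \<Rightarrow> (bgen list \<Rightarrow> complex) set" where
  "brauer_of_group m \<tau> w = the_elem ((\<lambda>u. brauer_word m \<tau> (gword u)) ` w)"

definition brauer_of_group_algebra ::
    "nat \<Rightarrow> complex \<Rightarrow> (sgen list set \<Rightarrow> complex) \<Rightarrow> (bgen list \<Rightarrow> complex) set" where
  "brauer_of_group_algebra m \<tau> f =
     (\<Oplus>\<^bsub>brauer_algebra m \<tau>\<^esub>w\<in>{w. f w \<noteq> 0}. f w \<odot>\<^bsub>brauer_algebra m \<tau>\<^esub> brauer_of_group m \<tau> w)"

text \<open>A map out of the Brauer algebra is made unique by restriction to the carrier.\<close>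

definition is_brauer_star ::
    "nat \<Rightarrow> complex \<Rightarrow> ((bgen list \<Rightarrow> complex) set \<Rightarrow> (bgen list \<Rightarrow> complex) set) \<Rightarrow> bool" where
  "is_brauer_star m \<tau> star \<longleftrightarrow>
     star \<in> extensional (carrier (brauer_algebra m \<tau>)) \<and>
     linear_anti_involution (brauer_algebra m \<tau>) star \<and>
     (\<forall>w\<in>carrier (dihedral m).
        star (brauer_of_group m \<tau> w) = brauer_of_group m \<tau> (inv\<^bsub>dihedral m\<^esub> w)) \<and>
     (\<forall>i<m. star (brauer_e m \<tau> i) = brauer_e m \<tau> i)"

definition brauer_star ::
    "nat \<Rightarrow> complex \<Rightarrow> (bgen list \<Rightarrow> complex) set \<Rightarrow> (bgen list \<Rightarrow> complex) set" where
  "brauer_star m \<tau> = (THE star. is_brauer_star m \<tau> star)"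


section \<open>The extended cell datum\<close>

text \<open>\<open>\<lambda>\<^sub>K\<^sub>r\<close> is \<open>None\<close>; the elements of \<open>M(\<lambda>)\<close> are tagged \<open>Inl\<close> and those of
  \<open>M(\<lambda>\<^sub>K\<^sub>r)\<close> are tagged \<open>Inr\<close>.\<close>

definition bar_Lambda :: "'l set \<Rightarrow> 'l option set" where
  "bar_Lambda \<Lambda> = insert None (Some ` \<Lambda>)"

definition bar_po :: "'l set \<Rightarrow> ('l \<times> 'l) set \<Rightarrow> ('l option \<times> 'l option) set" where
  "bar_po \<Lambda> po = {(Some k, Some l) | k l. (k, l) \<in> po} \<union> {None} \<times> bar_Lambda \<Lambda>"

fun bar_M :: "nat \<Rightarrow> ('l \<Rightarrow> 's set) \<Rightarrow> 'l option \<Rightarrow> ('s + nat) set" where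
  "bar_M m M (Some l) = Inl ` M l"
| "bar_M m M None = Inr ` {0..<m}"

text \<open>The elements \<open>w e\<^sub>j\<close> with \<open>w s\<^sub>j w\<inverse> = s\<^sub>i\<close>; their common value is \<open>kr_elem\<close>.\<close>

definition kr_elems :: "nat \<Rightarrow> complex \<Rightarrow> nat \<Rightarrow> nat \<Rightarrow> (bgen list \<Rightarrow> complex) set set" where
  "kr_elems m \<tau> i j =
     {brauer_of_group m \<tau> w \<otimes>\<^bsub>brauer_algebra m \<tau>\<^esub> brauer_e m \<tau> j | w.
        w \<in> carrier (dihedral m) \<and>
        w \<otimes>\<^bsub>dihedral m\<^esub> reflection m j \<otimes>\<^bsub>dihedral m\<^esub> inv\<^bsub>dihedral m\<^esub> w = reflection m i}"

definition kr_elem :: "nat \<Rightarrow> complex \<Rightarrow> nat \<Rightarrow> nat \<Rightarrow> (bgen list \<Rightarrow> complex) set" where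
  "kr_elem m \<tau> i j = the_elem (kr_elems m \<tau> i j)"

fun bar_C :: "nat \<Rightarrow> complex \<Rightarrow> ('l \<Rightarrow> 's \<Rightarrow> 's \<Rightarrow> sgen list set \<Rightarrow> complex)
    \<Rightarrow> 'l option \<Rightarrow> 's + nat \<Rightarrow> 's + nat \<Rightarrow> (bgen list \<Rightarrow> complex) set" where
  "bar_C m \<tau> C (Some l) (Inl S) (Inl T) = brauer_of_group_algebra m \<tau> (C l S T)"
| "bar_C m \<tau> C None (Inr i) (Inr j) = kr_elem m \<tau> i j"
| "bar_C m \<tau> C _ _ _ = undefined"

end

theory Submission
  imports Defs "HOL-Number_Theory.Cong"
begin

text \<open>
  Let \<open>e\<^sub>i\<close> correspond to the matrix unit \<open>E\<^sub>i\<^sub>i\<close> and \<open>w e\<^sub>j\<close> to \<open>E\<^sub>i\<^sub>j\<close>, where \<open>w s\<^sub>j = s\<^sub>i w\<close>. Since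
  \<open>m\<close> is odd, the group acts transitively on the reflections with stabilizer \<open>{1, s\<^sub>j}\<close>, and
  \<open>s\<^sub>j\<close> fixes \<open>e\<^sub>j\<close>, so \<open>w e\<^sub>j\<close> depends only on \<open>i\<close> and \<open>j\<close>. The relations
  give \<open>E\<^sub>i\<^sub>j E\<^sub>k\<^sub>l = p\<^sub>j\<^sub>k E\<^sub>i\<^sub>l\<close> with \<open>p\<^sub>j\<^sub>j = \<tau>\<close> and \<open>p\<^sub>j\<^sub>k = 1\<close> for \<open>j \<noteq> k\<close>.
  Hence products of the elements \<open>w\<close> and \<open>E\<^sub>i\<^sub>j\<close> are again such elements up to a scalar, and they
  span the algebra. Conversely this multiplication table is associative because \<open>p\<close> is
  invariant under the group. So every word in the generators has a well-defined coordinate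
  vector in the formal span of the \<open>w\<close> and \<open>E\<^sub>i\<^sub>j\<close>, compatible with the relations, and
  the \<open>w\<close> and \<open>E\<^sub>i\<^sub>j\<close> form a basis. All axioms of a cellular structure are then
  checked on coordinates; modulo the span of the \<open>E\<^sub>i\<^sub>j\<close> the algebra is the group algebra.
\<close>

section \<open>Monoid algebras\<close>

text \<open>Spanning is a rewriting argument. Independence is harder, because the algebra is a
  quotient of a free algebra by a generated ideal. A functional on words descends to that quotient
  only if it kills every relator in every context, so relators are tested between arbitrary words on
  both sides. This is manageable since every relation equates a scalar multiple of one word with a
  scalar multiple of another. Cells and scalars are tracked separately, so \<tau> = 0 needs no
  special treatment. The group enters through its action on the integers modulo m in which
  \<open>s i\<close> is x -> i - x. Conjugation by \<open>s k\<close> then sends the index j to 2k -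
  j. For odd m the number 2 is invertible, which yields transitivity, the stabilizers and k(i,j) =
  (i + j)/2. The value p(j,k) = 1 for distinct j, k comes from the relations \<open>e_e_left\<close>
  and \<open>e_e_right\<close>: the product of e(j) and e(k) is g e(k) for a reflection g that
  conjugates \<open>s k\<close> to \<open>s j\<close>, and this is the matrix unit with indices j,
  k.\<close>

lemma complex_ring_simps [simp]:
  "carrier complex_ring = UNIV" "\<one>\<^bsub>complex_ring\<^esub> = 1" "\<zero>\<^bsub>complex_ring\<^esub> = 0"
  "x \<otimes>\<^bsub>complex_ring\<^esub> y = x * y" "x \<oplus>\<^bsub>complex_ring\<^esub> y = x + y"
  by (simp_all add: complex_ring_def)

lemma cring_complex_ring: "cring complex_ring"
proof (rule cringI)
  show "abelian_group complex_ring"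
    by (rule abelian_groupI) (auto simp: algebra_simps intro: exI[of _ "- _"])
  show "comm_monoid complex_ring"
    by (rule comm_monoidI) auto
qed (simp add: algebra_simps)

lemma monoid_algebra_simps:
  "carrier (monoid_algebra G) = {f. finite {x. f x \<noteq> 0} \<and> {x. f x \<noteq> 0} \<subseteq> carrier G}"
  "f \<oplus>\<^bsub>monoid_algebra G\<^esub> g = (\<lambda>x. f x + g x)"
  "c \<odot>\<^bsub>monoid_algebra G\<^esub> f = (\<lambda>x. c * f x)"
  "\<zero>\<^bsub>monoid_algebra G\<^esub> = (\<lambda>_. 0)"
  "\<one>\<^bsub>monoid_algebra G\<^esub> = (\<lambda>_. 0)(\<one>\<^bsub>G\<^esub> := 1)"
  by (simp_all add: monoid_algebra_def)

text \<open>The linear extension of \<phi> to the monoid algebra, evaluated at f. Describing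
  elements by such functionals replaces sums over the fibres of the multiplication by nested
  evaluations.\<close>

definition pairing :: "('g \<Rightarrow> complex) \<Rightarrow> ('g \<Rightarrow> complex) \<Rightarrow> complex" where
  "pairing f \<phi> = (\<Sum>x | f x \<noteq> 0. f x * \<phi> x)"

lemma pairing_superset:
  assumes "finite S" "{x. f x \<noteq> 0} \<subseteq> S"
  shows "pairing f \<phi> = (\<Sum>x\<in>S. f x * \<phi> x)"
  unfolding pairing_def using assms by (intro sum.mono_neutral_left) auto

lemma pairing_add_left:
  assumes "finite {x. f x \<noteq> 0}" "finite {x. g x \<noteq> 0}"
  shows "pairing (\<lambda>x. f x + g x) \<phi> = pairing f \<phi> + pairing g \<phi>"
proof -
  let ?S = "{x. f x \<noteq> 0} \<union> {x. g x \<noteq> 0}"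
  have "pairing (\<lambda>x. f x + g x) \<phi> = (\<Sum>x\<in>?S. (f x + g x) * \<phi> x)"
       "pairing f \<phi> = (\<Sum>x\<in>?S. f x * \<phi> x)" "pairing g \<phi> = (\<Sum>x\<in>?S. g x * \<phi> x)"
    using assms by (auto intro!: pairing_superset)
  then show ?thesis by (simp add: algebra_simps sum.distrib)
qed

lemma pairing_scale_left: "pairing (\<lambda>x. c * f x) \<phi> = c * pairing f \<phi>"
  by (cases "c = 0") (auto simp: pairing_def sum_distrib_left mult.assoc)

lemma pairing_zero_left [simp]: "pairing (\<lambda>x. 0) \<phi> = 0"
  by (simp add: pairing_def)

lemma pairing_zero_right [simp]: "pairing f (\<lambda>x. 0) = 0"
  by (simp add: pairing_def)

lemma pairing_scale_right: "pairing f (\<lambda>x. c * \<phi> x) = c * pairing f \<phi>"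
  by (simp add: pairing_def sum_distrib_left mult_ac)

lemma pairing_add_right: "pairing f (\<lambda>x. \<phi> x + \<psi> x) = pairing f \<phi> + pairing f \<psi>"
  by (simp add: pairing_def sum.distrib algebra_simps)

lemma pairing_single [simp]: "pairing ((\<lambda>_. 0)(u := c)) \<phi> = c * \<phi> u"
  by (subst pairing_superset[of "{u}"]) auto

lemma pairing_indicator:
  assumes "finite {x. f x \<noteq> 0}"
  shows "pairing f (\<lambda>y. if y = x then 1 else 0) = f x"
proof -
  have "(\<Sum>y\<in>insert x {x. f x \<noteq> 0}. f y * (if y = x then 1 else 0)) = f x"
    using assms by (simp add: if_distrib[of "(*) _"] sum.delta cong: if_cong del: sum.insert)
  then show ?thesis
    using assms by (subst pairing_superset[of "insert x {x. f x \<noteq> 0}"]) auto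
qed

section \<open>Convolution as a nested pairing\<close>

lemma monoid_algebra_mult:
  assumes "finite {x. f x \<noteq> 0}" "finite {x. g x \<noteq> 0}"
  shows "(f \<otimes>\<^bsub>monoid_algebra G\<^esub> g) x
    = pairing f (\<lambda>y. pairing g (\<lambda>z. if y \<otimes>\<^bsub>G\<^esub> z = x then 1 else 0))"
proof -
  let ?D = "{x. f x \<noteq> 0} \<times> {x. g x \<noteq> 0}"
  have "(f \<otimes>\<^bsub>monoid_algebra G\<^esub> g) x
      = (\<Sum>(y, z)\<in>{p \<in> ?D. fst p \<otimes>\<^bsub>G\<^esub> snd p = x}. f y * g z)"
    by (auto simp: monoid_algebra_def intro!: sum.cong)
  also have "\<dots> = (\<Sum>(y, z)\<in>?D. if y \<otimes>\<^bsub>G\<^esub> z = x then f y * g z else 0)"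
    using assms by (subst sum.inter_filter) (auto intro!: sum.cong)
  also have "\<dots> = (\<Sum>y | f y \<noteq> 0. \<Sum>z | g z \<noteq> 0. if y \<otimes>\<^bsub>G\<^esub> z = x then f y * g z else 0)"
    by (simp add: sum.cartesian_product)
  also have "\<dots> = pairing f (\<lambda>y. pairing g (\<lambda>z. if y \<otimes>\<^bsub>G\<^esub> z = x then 1 else 0))"
    by (auto simp: pairing_def sum_distrib_left intro!: sum.cong)
  finally show ?thesis .
qed

lemma monoid_algebra_mult_support:
  assumes "finite {x. f x \<noteq> 0}" "finite {x. g x \<noteq> 0}"
  shows "{x. (f \<otimes>\<^bsub>monoid_algebra G\<^esub> g) x \<noteq> 0}
    \<subseteq> (\<lambda>(y, z). y \<otimes>\<^bsub>G\<^esub> z) ` ({x. f x \<noteq> 0} \<times> {x. g x \<noteq> 0})"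
proof
  fix x assume "x \<in> {x. (f \<otimes>\<^bsub>monoid_algebra G\<^esub> g) x \<noteq> 0}"
  then have "{(y, z). f y \<noteq> 0 \<and> g z \<noteq> 0 \<and> y \<otimes>\<^bsub>G\<^esub> z = x} \<noteq> {}"
    by (auto simp: monoid_algebra_def simp del: Collect_empty_eq dest: sum.not_neutral_contains_not_neutral)
  then show "x \<in> (\<lambda>(y, z). y \<otimes>\<^bsub>G\<^esub> z) ` ({x. f x \<noteq> 0} \<times> {x. g x \<noteq> 0})"
    by auto
qed

text \<open>The form in which convolution is used from here on: associativity, the ideal property of
  \<open>annihilator\<close> and the multiplication rule for coordinates all reduce to statements
  about single products under the nested pairings.\<close>

lemma pairing_mult:
  assumes "finite {x. f x \<noteq> 0}" "finite {x. g x \<noteq> 0}"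
  shows "pairing (f \<otimes>\<^bsub>monoid_algebra G\<^esub> g) \<phi> = pairing f (\<lambda>y. pairing g (\<lambda>z. \<phi> (y \<otimes>\<^bsub>G\<^esub> z)))"
proof -
  let ?F = "{x. f x \<noteq> 0}" and ?H = "{x. g x \<noteq> 0}"
  let ?S = "(\<lambda>(y, z). y \<otimes>\<^bsub>G\<^esub> z) ` (?F \<times> ?H)"
  have fin: "finite ?S" using assms by auto
  have "pairing (f \<otimes>\<^bsub>monoid_algebra G\<^esub> g) \<phi> = (\<Sum>x\<in>?S. (f \<otimes>\<^bsub>monoid_algebra G\<^esub> g) x * \<phi> x)"
    by (intro pairing_superset fin monoid_algebra_mult_support assms)
  also have "\<dots> = (\<Sum>x\<in>?S. \<Sum>y\<in>?F. \<Sum>z\<in>?H. f y * g z * (if y \<otimes>\<^bsub>G\<^esub> z = x then \<phi> x else 0))"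
    by (auto simp: monoid_algebra_mult[OF assms] pairing_def sum_distrib_left sum_distrib_right
        intro!: sum.cong)
  also have "\<dots> = (\<Sum>y\<in>?F. \<Sum>x\<in>?S. \<Sum>z\<in>?H. f y * g z * (if y \<otimes>\<^bsub>G\<^esub> z = x then \<phi> x else 0))"
    by (rule sum.swap)
  also have "\<dots> = (\<Sum>y\<in>?F. \<Sum>z\<in>?H. \<Sum>x\<in>?S. f y * g z * (if y \<otimes>\<^bsub>G\<^esub> z = x then \<phi> x else 0))"
    by (intro sum.cong refl sum.swap)
  also have "\<dots> = (\<Sum>y\<in>?F. \<Sum>z\<in>?H. f y * g z * \<phi> (y \<otimes>\<^bsub>G\<^esub> z))"
  proof (intro sum.cong refl)
    fix y z assume "y \<in> ?F" "z \<in> ?H"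
    then have "y \<otimes>\<^bsub>G\<^esub> z \<in> ?S" by force
    then show "(\<Sum>x\<in>?S. f y * g z * (if y \<otimes>\<^bsub>G\<^esub> z = x then \<phi> x else 0)) = f y * g z * \<phi> (y \<otimes>\<^bsub>G\<^esub> z)"
      using fin by (simp add: sum_distrib_left[symmetric])
  qed
  also have "\<dots> = pairing f (\<lambda>y. pairing g (\<lambda>z. \<phi> (y \<otimes>\<^bsub>G\<^esub> z)))"
    by (simp add: pairing_def sum_distrib_left mult.assoc)
  finally show ?thesis .
qed

lemma pairing_cong:
  assumes "\<And>x. f x \<noteq> 0 \<Longrightarrow> \<phi> x = \<psi> x"
  shows "pairing f \<phi> = pairing f \<psi>"
  using assms by (simp add: pairing_def)

lemma pairing_sum_right:
  "pairing f (\<lambda>x. \<Sum>a\<in>S. \<phi> a x) = (\<Sum>a\<in>S. pairing f (\<phi> a))"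
  unfolding pairing_def sum_distrib_left by (rule sum.swap)

text \<open>The factor k will be a structure constant, and the order of the factors is the one
  produced in \<open>coord_mult\<close>.\<close>

lemma pairing_product:
  "pairing f (\<lambda>x. pairing g (\<lambda>y. k * \<psi> y * \<phi> x)) = k * (pairing f \<phi> * pairing g \<psi>)"
proof -
  have "pairing g (\<lambda>y. k * \<psi> y * \<phi> x) = (k * pairing g \<psi>) * \<phi> x" for x
    by (simp add: pairing_def sum_distrib_left sum_distrib_right mult_ac)
  then show ?thesis by (simp add: pairing_scale_right)
qed

lemma monoid_algebra_mult_closed:
  assumes "monoid G" "f \<in> carrier (monoid_algebra G)" "g \<in> carrier (monoid_algebra G)"
  shows "f \<otimes>\<^bsub>monoid_algebra G\<^esub> g \<in> carrier (monoid_algebra G)"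
proof -
  interpret monoid G by fact
  have *: "finite {x. f x \<noteq> 0}" "finite {x. g x \<noteq> 0}" "{x. f x \<noteq> 0} \<subseteq> carrier G" "{x. g x \<noteq> 0} \<subseteq> carrier G"
    using assms(2,3) by (auto simp: monoid_algebra_simps)
  have "finite ((\<lambda>(y, z). y \<otimes>\<^bsub>G\<^esub> z) ` ({x. f x \<noteq> 0} \<times> {x. g x \<noteq> 0}))"
       "(\<lambda>(y, z). y \<otimes>\<^bsub>G\<^esub> z) ` ({x. f x \<noteq> 0} \<times> {x. g x \<noteq> 0}) \<subseteq> carrier G"
    using * by auto
  then show ?thesis
    using monoid_algebra_mult_support[OF *(1,2), of G]
    by (auto simp: monoid_algebra_simps(1) intro: finite_subset)
qed

lemma monoid_algebra_complex_algebra: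
  fixes G :: "'g monoid" (structure)
  assumes "monoid G"
  shows "complex_algebra (monoid_algebra G)"
proof -
  interpret monoid G by fact
  let ?A = "monoid_algebra G"
  have fin: "finite {x. f x \<noteq> 0}" if "f \<in> carrier ?A" for f
    using that by (simp add: monoid_algebra_simps)
  have fin1: "finite {x. ((\<lambda>_. 0)(u := c)) x \<noteq> (0::complex)}" for u :: 'g and c
    by (rule finite_subset[of _ "{u}"]) auto
  have finadd: "finite {x. f x + g x \<noteq> 0}" if "f \<in> carrier ?A" "g \<in> carrier ?A" for f g
    by (rule finite_subset[of _ "{x. f x \<noteq> 0} \<union> {x. g x \<noteq> 0}"]) (use fin that in auto)
  have finscale: "finite {x. c * f x \<noteq> 0}" if "f \<in> carrier ?A" for f and c :: complex
    by (rule finite_subset[of _ "{x. f x \<noteq> 0}"]) (use fin that in auto)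
  have scale_closed: "c \<odot>\<^bsub>?A\<^esub> f \<in> carrier ?A" if "f \<in> carrier ?A" for c f
    using that finscale[OF that, of c] by (auto simp: monoid_algebra_simps)
  have one_closed: "\<one>\<^bsub>?A\<^esub> \<in> carrier ?A"
    using fin1[of "\<one>" 1] by (auto simp: monoid_algebra_simps)
  have sup: "x \<in> carrier G" if "f \<in> carrier ?A" "f x \<noteq> 0" for f x
    using that by (auto simp: monoid_algebra_simps)
  have ag: "abelian_group ?A"
  proof (rule abelian_groupI)
    fix f assume f: "f \<in> carrier ?A"
    show "\<exists>g\<in>carrier ?A. g \<oplus>\<^bsub>?A\<^esub> f = \<zero>\<^bsub>?A\<^esub>"
      by (rule bexI[OF _ scale_closed[OF f, of "-1"]]) (simp add: monoid_algebra_simps)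
  next
    fix f g assume fg: "f \<in> carrier ?A" "g \<in> carrier ?A"
    have "x \<in> carrier G" if "f x + g x \<noteq> 0" for x
      using that sup[OF fg(1)] sup[OF fg(2)] by (cases "f x = 0") auto
    then show "f \<oplus>\<^bsub>?A\<^esub> g \<in> carrier ?A"
      using finadd[OF fg] by (auto simp: monoid_algebra_simps)
  qed (auto simp: monoid_algebra_simps algebra_simps)
  have ring: "ring ?A"
  proof (rule ringI)
    show "abelian_group ?A" by (rule ag)
    show "monoid ?A"
    proof (rule monoidI)
      fix f g assume "f \<in> carrier ?A" "g \<in> carrier ?A"
      then show "f \<otimes>\<^bsub>?A\<^esub> g \<in> carrier ?A" by (rule monoid_algebra_mult_closed[OF assms])
    next
      fix f g h assume fgh: "f \<in> carrier ?A" "g \<in> carrier ?A" "h \<in> carrier ?A"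
      note closed = monoid_algebra_mult_closed[OF assms]
      have "(f \<otimes>\<^bsub>?A\<^esub> g \<otimes>\<^bsub>?A\<^esub> h) x = pairing f (\<lambda>y. pairing g (\<lambda>z. pairing h
          (\<lambda>w. if y \<otimes> z \<otimes> w = x then 1 else 0)))" for x
        using fgh closed by (subst monoid_algebra_mult[OF fin fin]) (simp_all add: pairing_mult[OF fin fin])
      \<comment> \<open>Associativity of G is available on its carrier only;
        \<open>pairing_cong\<close> suffices because the supports lie there.\<close>
      also have "\<dots> x = pairing f (\<lambda>y. pairing g (\<lambda>z. pairing h
          (\<lambda>w. if y \<otimes> (z \<otimes> w) = x then 1 else 0)))" for x
        by (intro pairing_cong) (simp add: sup[OF fgh(1)] sup[OF fgh(2)] sup[OF fgh(3)] m_assoc)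
      also have "\<dots> x = (f \<otimes>\<^bsub>?A\<^esub> (g \<otimes>\<^bsub>?A\<^esub> h)) x" for x
        using fgh closed by (subst monoid_algebra_mult[OF fin fin]) (simp_all add: pairing_mult[OF fin fin])
      finally have "(f \<otimes>\<^bsub>?A\<^esub> g \<otimes>\<^bsub>?A\<^esub> h) x = (f \<otimes>\<^bsub>?A\<^esub> (g \<otimes>\<^bsub>?A\<^esub> h)) x" for x .
      then show "f \<otimes>\<^bsub>?A\<^esub> g \<otimes>\<^bsub>?A\<^esub> h = f \<otimes>\<^bsub>?A\<^esub> (g \<otimes>\<^bsub>?A\<^esub> h)" ..
    next
      fix f assume f: "f \<in> carrier ?A"
      have "(\<one>\<^bsub>?A\<^esub> \<otimes>\<^bsub>?A\<^esub> f) x = pairing f (\<lambda>z. if \<one> \<otimes> z = x then 1 else 0)" for x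
        using f by (simp add: monoid_algebra_mult fin one_closed) (simp add: monoid_algebra_simps)
      also have "\<dots> x = pairing f (\<lambda>z. if z = x then 1 else 0)" for x
        by (intro pairing_cong) (simp add: sup[OF f])
      finally show "\<one>\<^bsub>?A\<^esub> \<otimes>\<^bsub>?A\<^esub> f = f"
        by (simp add: pairing_indicator fin[OF f] fun_eq_iff)
      have "(f \<otimes>\<^bsub>?A\<^esub> \<one>\<^bsub>?A\<^esub>) x = pairing f (\<lambda>z. if z \<otimes> \<one> = x then 1 else 0)" for x
        using f by (simp add: monoid_algebra_mult fin one_closed) (simp add: monoid_algebra_simps)
      also have "\<dots> x = pairing f (\<lambda>z. if z = x then 1 else 0)" for x
        by (intro pairing_cong) (simp add: sup[OF f])
      finally show "f \<otimes>\<^bsub>?A\<^esub> \<one>\<^bsub>?A\<^esub> = f"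
        by (simp add: pairing_indicator fin[OF f] fun_eq_iff)
    qed (rule one_closed)
  next
    fix f g h assume fgh: "f \<in> carrier ?A" "g \<in> carrier ?A" "h \<in> carrier ?A"
    then show "(f \<oplus>\<^bsub>?A\<^esub> g) \<otimes>\<^bsub>?A\<^esub> h = f \<otimes>\<^bsub>?A\<^esub> h \<oplus>\<^bsub>?A\<^esub> g \<otimes>\<^bsub>?A\<^esub> h"
      by (auto simp: fun_eq_iff monoid_algebra_mult fin finadd monoid_algebra_simps(2) pairing_add_left)
    show "h \<otimes>\<^bsub>?A\<^esub> (f \<oplus>\<^bsub>?A\<^esub> g) = h \<otimes>\<^bsub>?A\<^esub> f \<oplus>\<^bsub>?A\<^esub> h \<otimes>\<^bsub>?A\<^esub> g"
      using fgh
      by (auto simp: fun_eq_iff monoid_algebra_mult fin finadd monoid_algebra_simps(2) pairing_add_left pairing_add_right)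
  qed
  have mod: "Module.module complex_ring ?A"
    by (intro moduleI cring_complex_ring ag scale_closed)
      (auto simp: monoid_algebra_simps algebra_simps)
  show ?thesis
  proof (intro complex_algebra.intro mod ring complex_algebra_axioms.intro)
    fix f g c assume fg: "f \<in> carrier ?A" "g \<in> carrier ?A"
    show "(c \<odot>\<^bsub>?A\<^esub> f) \<otimes>\<^bsub>?A\<^esub> g = c \<odot>\<^bsub>?A\<^esub> (f \<otimes>\<^bsub>?A\<^esub> g)"
      using fg
      by (auto simp: fun_eq_iff monoid_algebra_mult fin finscale monoid_algebra_simps(3) pairing_scale_left)
    show "f \<otimes>\<^bsub>?A\<^esub> (c \<odot>\<^bsub>?A\<^esub> g) = c \<odot>\<^bsub>?A\<^esub> (f \<otimes>\<^bsub>?A\<^esub> g)"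
      using fg
      by (auto simp: fun_eq_iff monoid_algebra_mult fin finscale monoid_algebra_simps(3) pairing_scale_left pairing_scale_right)
  qed
qed

lemma (in complex_algebra) scalar_simps:
  assumes "x \<in> carrier A"
  shows "c \<odot> x \<in> carrier A" "(a + b) \<odot> x = a \<odot> x \<oplus> b \<odot> x" "(a * b) \<odot> x = a \<odot> (b \<odot> x)"
    "1 \<odot> x = x" "0 \<odot> x = \<zero>"
  using assms smult_closed[of c x] smult_l_distr[of a b x] smult_assoc1[of a b x] smult_one[of x]
    smult_l_null[of x]
  by simp_all

section \<open>Presented algebras\<close>

lemma free_monoid_simps [simp]:
  "carrier (free_monoid X) = lists X" "\<one>\<^bsub>free_monoid X\<^esub> = []"
  "u \<otimes>\<^bsub>free_monoid X\<^esub> v = u @ v"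
  by (simp_all add: free_monoid_def)

lemma monoid_free_monoid: "monoid (free_monoid X)"
  by (rule monoidI) auto

lemma complex_algebra_free_algebra: "complex_algebra (free_algebra X)"
  by (rule monoid_algebra_complex_algebra[OF monoid_free_monoid])

lemma monomial_closed:
  assumes "u \<in> lists X"
  shows "monomial c u \<in> carrier (free_algebra X)"
proof -
  have "{x. monomial c u x \<noteq> 0} \<subseteq> {u}" by (auto simp: monomial_def)
  then show ?thesis
    using assms finite_subset[of _ "{u}"] by (auto simp: monoid_algebra_simps)
qed

lemma pairing_monomial [simp]: "pairing (monomial c u) \<phi> = c * \<phi> u"
  by (simp add: monomial_def)

lemma monomial_mult:
  assumes "u \<in> lists X" "v \<in> lists X"
  shows "monomial c u \<otimes>\<^bsub>free_algebra X\<^esub> monomial d v = monomial (c * d) (u @ v)"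
proof
  fix x
  have "finite {x. monomial c u x \<noteq> 0}" "finite {x. monomial d v x \<noteq> 0}"
    using monomial_closed[OF assms(1), of c] monomial_closed[OF assms(2), of d]
    by (auto simp: monoid_algebra_simps)
  then show "(monomial c u \<otimes>\<^bsub>free_algebra X\<^esub> monomial d v) x = monomial (c * d) (u @ v) x"
    by (subst monoid_algebra_mult) (auto simp: monomial_def)
qed

lemma free_algebra_induct [consumes 1, case_names zero add]:
  assumes f: "f \<in> carrier (free_algebra X)"
    and zero: "P \<zero>\<^bsub>free_algebra X\<^esub>"
    and add: "\<And>f c u. \<lbrakk>f \<in> carrier (free_algebra X); u \<in> lists X; P f\<rbrakk>
      \<Longrightarrow> P (f \<oplus>\<^bsub>free_algebra X\<^esub> monomial c u)"
  shows "P f"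
proof -
  have "finite {x. f x \<noteq> 0}" using f by (simp add: monoid_algebra_simps)
  moreover have "P f" if "finite S" "f \<in> carrier (free_algebra X)" "{x. f x \<noteq> 0} = S" for S f
    using that
  proof (induction S arbitrary: f)
    case empty
    then have "f = \<zero>\<^bsub>free_algebra X\<^esub>" by (auto simp: monoid_algebra_simps)
    then show ?case using zero by simp
  next
    case (insert u S)
    define g where "g = f(u := 0)"
    have g: "{x. g x \<noteq> 0} = S" using insert by (auto simp: g_def)
    with insert have "g \<in> carrier (free_algebra X)" "u \<in> lists X"
      by (auto simp: monoid_algebra_simps)
    moreover have "f = g \<oplus>\<^bsub>free_algebra X\<^esub> monomial (f u) u"
      by (auto simp: g_def monoid_algebra_simps monomial_def)
    ultimately show ?case using add insert.IH g by metis
  qed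
  ultimately show ?thesis using f by blast
qed

locale algebra_presentation =
  fixes X :: "'g set" and R :: "(('g list \<Rightarrow> complex) \<times> ('g list \<Rightarrow> complex)) set"
  assumes relations_closed: "(p, q) \<in> R \<Longrightarrow>
    p \<in> carrier (free_algebra X) \<and> q \<in> carrier (free_algebra X)"
begin

sublocale F: complex_algebra "free_algebra X"
  by (rule complex_algebra_free_algebra)

abbreviation "A \<equiv> presented_algebra X R"
abbreviation "I \<equiv> relation_ideal X R"

definition proj :: "('g list \<Rightarrow> complex) \<Rightarrow> ('g list \<Rightarrow> complex) set" where
  "proj p = I +>\<^bsub>free_algebra X\<^esub> p"

lemma relators_closed:
  "{p \<ominus>\<^bsub>free_algebra X\<^esub> q | p q. (p, q) \<in> R} \<subseteq> carrier (free_algebra X)"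
  using relations_closed by auto

sublocale ideal I "free_algebra X"
  unfolding relation_ideal_def by (rule F.genideal_ideal[OF relators_closed])

text \<open>The ideal is generated in the ring sense. It is a subspace all the same, because a
  scalar multiple of p is the product of the scaled unit with p.\<close>

lemma smult_ideal: "p \<in> I \<Longrightarrow> c \<odot>\<^bsub>free_algebra X\<^esub> p \<in> I"
  using I_l_closed[of p "c \<odot>\<^bsub>free_algebra X\<^esub> \<one>\<^bsub>free_algebra X\<^esub>"] a_Hcarr[of p]
  by (simp add: F.smult_mult_left)

lemma proj_eq_iff:
  assumes "p \<in> carrier (free_algebra X)" "q \<in> carrier (free_algebra X)"
  shows "proj p = proj q \<longleftrightarrow> p \<ominus>\<^bsub>free_algebra X\<^esub> q \<in> I"
  unfolding proj_def using F.quotient_eq_iff_same_a_r_cos[OF ideal_axioms assms] by simp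

lemma proj_self: "p \<in> carrier (free_algebra X) \<Longrightarrow> p \<in> proj p"
  unfolding proj_def by (rule a_rcos_self)

lemma proj_memD:
  assumes "p \<in> carrier (free_algebra X)" "q \<in> proj p"
  shows "q \<in> carrier (free_algebra X)" "proj q = proj p"
proof -
  have "q \<in> I +>\<^bsub>free_algebra X\<^esub> p" using assms(2) by (simp only: proj_def)
  from subsetD[OF F.a_r_coset_subset_G[OF a_subset assms(1)] this]
    F.a_repr_independence[OF this assms(1) a_subgroup]
  show "q \<in> carrier (free_algebra X)" "proj q = proj p" by (simp_all only: proj_def)
qed

lemma presented_algebra_simps:
  "carrier A = proj ` carrier (free_algebra X)"
  "p \<in> carrier (free_algebra X) \<Longrightarrow> q \<in> carrier (free_algebra X)
    \<Longrightarrow> proj p \<oplus>\<^bsub>A\<^esub> proj q = proj (p \<oplus>\<^bsub>free_algebra X\<^esub> q)"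
  "p \<in> carrier (free_algebra X) \<Longrightarrow> q \<in> carrier (free_algebra X)
    \<Longrightarrow> proj p \<otimes>\<^bsub>A\<^esub> proj q = proj (p \<otimes>\<^bsub>free_algebra X\<^esub> q)"
  "\<one>\<^bsub>A\<^esub> = proj \<one>\<^bsub>free_algebra X\<^esub>"
  "\<zero>\<^bsub>A\<^esub> = proj \<zero>\<^bsub>free_algebra X\<^esub>"
proof -
  note d = presented_algebra_def ring.defs module.defs FactRing_def proj_def
  show "carrier A = proj ` carrier (free_algebra X)"
    by (auto simp: d A_RCOSETS_def')
  show "p \<in> carrier (free_algebra X) \<Longrightarrow> q \<in> carrier (free_algebra X)
    \<Longrightarrow> proj p \<oplus>\<^bsub>A\<^esub> proj q = proj (p \<oplus>\<^bsub>free_algebra X\<^esub> q)"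
    by (simp add: d a_rcos_sum)
  show "p \<in> carrier (free_algebra X) \<Longrightarrow> q \<in> carrier (free_algebra X)
    \<Longrightarrow> proj p \<otimes>\<^bsub>A\<^esub> proj q = proj (p \<otimes>\<^bsub>free_algebra X\<^esub> q)"
    by (simp add: d rcoset_mult_add)
  show "\<one>\<^bsub>A\<^esub> = proj \<one>\<^bsub>free_algebra X\<^esub>" by (simp add: d)
  show "\<zero>\<^bsub>A\<^esub> = proj \<zero>\<^bsub>free_algebra X\<^esub>"
    using F.a_coset_add_zero[OF a_subset] by (simp add: d)
qed

text \<open>Scalar multiplication on cosets is defined as a union over all representatives.
  Representatives differ by elements of \<open>I\<close>, which is closed under scalars, so all
  members of the union are the same coset.\<close>

lemma proj_smult:
  assumes p: "p \<in> carrier (free_algebra X)"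
  shows "c \<odot>\<^bsub>A\<^esub> proj p = proj (c \<odot>\<^bsub>free_algebra X\<^esub> p)"
proof -
  have "proj (c \<odot>\<^bsub>free_algebra X\<^esub> q) = proj (c \<odot>\<^bsub>free_algebra X\<^esub> p)" if "q \<in> proj p" for q
  proof -
    have q: "q \<in> carrier (free_algebra X)" "q \<ominus>\<^bsub>free_algebra X\<^esub> p \<in> I"
      using proj_memD[OF p that] p proj_eq_iff by auto
    have "c \<odot>\<^bsub>free_algebra X\<^esub> q \<ominus>\<^bsub>free_algebra X\<^esub> c \<odot>\<^bsub>free_algebra X\<^esub> p
        = c \<odot>\<^bsub>free_algebra X\<^esub> (q \<ominus>\<^bsub>free_algebra X\<^esub> p)"
      using p q by (simp add: F.minus_eq F.smult_r_distr F.smult_r_minus)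
    then show ?thesis
      using smult_ideal[OF q(2), of c] p q by (simp add: proj_eq_iff)
  qed
  then have "(\<Union>q\<in>proj p. proj (c \<odot>\<^bsub>free_algebra X\<^esub> q))
      = (\<Union>q\<in>proj p. proj (c \<odot>\<^bsub>free_algebra X\<^esub> p))"
    by (intro SUP_cong refl)
  also have "\<dots> = proj (c \<odot>\<^bsub>free_algebra X\<^esub> p)"
    using proj_self[OF p] by blast
  finally show ?thesis
    by (simp add: presented_algebra_def ring.defs module.defs proj_def)
qed

lemma complex_algebra_presented: "complex_algebra A"
proof -
  have ring: "ring A"
  proof (rule ringI)
    show "abelian_group A"
    proof (rule abelian_groupI)
      fix P assume "P \<in> carrier A"
      then obtain p where "p \<in> carrier (free_algebra X)" "P = proj p"
        by (auto simp: presented_algebra_simps)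
      then show "\<exists>Q\<in>carrier A. Q \<oplus>\<^bsub>A\<^esub> P = \<zero>\<^bsub>A\<^esub>"
        by (intro bexI[of _ "proj (\<ominus>\<^bsub>free_algebra X\<^esub> p)"])
          (auto simp: presented_algebra_simps F.l_neg)
    qed (auto simp: presented_algebra_simps F.a_ac)
    show "monoid A"
      by (rule monoidI) (auto simp: presented_algebra_simps F.m_assoc)
  qed (auto simp: presented_algebra_simps F.l_distr F.r_distr)
  then interpret A: ring A .
  have mod: "Module.module complex_ring A"
    by (intro moduleI cring_complex_ring A.abelian_group_axioms)
      (auto simp: presented_algebra_simps proj_smult F.scalar_simps F.smult_r_distr)
  show ?thesis
    by (intro complex_algebra.intro mod ring complex_algebra_axioms.intro)
      (auto simp: presented_algebra_simps proj_smult F.smult_mult_left F.smult_mult_right)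
qed

lemma proj_relation:
  assumes "(p, q) \<in> R"
  shows "proj p = proj q"
proof -
  have "p \<ominus>\<^bsub>free_algebra X\<^esub> q \<in> I"
    unfolding relation_ideal_def
    by (rule subsetD[OF F.genideal_self[OF relators_closed]]) (use assms in blast)
  then show ?thesis using relations_closed[OF assms] by (simp add: proj_eq_iff)
qed

end

section \<open>The dihedral group\<close>

lemma word_cong_append_right: "word_cong R u v \<Longrightarrow> word_cong R (u @ w) (v @ w)"
  and word_cong_append_left: "word_cong R u v \<Longrightarrow> word_cong R (w @ u) (w @ v)"
  by (auto intro: word_cong.intros)

lemma Collect_word_cong_eq_iff: "Collect (word_cong R u) = Collect (word_cong R v) \<longleftrightarrow> word_cong R u v"
  by (auto intro: word_cong.reflexive word_cong.symmetric word_cong.transitive)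

text \<open>The infinite dihedral group acting on the integers, with the leftmost letter applied
  last. Reduced modulo m it is a faithful model of the group when m is at least 3, and it decides
  the word problem.\<close>

fun affine :: "sgen list \<Rightarrow> int \<Rightarrow> int" where
  "affine [] x = x"
| "affine (S0 # u) x = - affine u x"
| "affine (S1 # u) x = 1 - affine u x"

lemma affine_append: "affine (u @ v) x = affine u (affine v x)"
  by (induction u x rule: affine.induct) auto

lemma affine_eq: "affine u x = affine u 0 + (if even (length u) then x else - x)"
  by (induction u x rule: affine.induct) auto

lemma affine_rotation: "affine (concat (replicate k [S0, S1])) x = x - int k"
  by (induction k) auto

text \<open>The recursion becomes (i-1) - ((i-2) - ((i-1) - x)) = i - x.\<close>

lemma affine_reflection_word: "affine (reflection_word i) x = int i - x"
  by (induction i arbitrary: x rule: reflection_word.induct) (auto simp: affine_append)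

lemma rev_reflection_word: "rev (reflection_word i) = reflection_word i"
  by (induction i rule: reflection_word.induct) auto

lemma affine_rev: "affine (rev u) (affine u x) = x"
  by (induction u x rule: affine.induct) (auto simp: affine_append)

definition affine_cong :: "nat \<Rightarrow> sgen list \<Rightarrow> sgen list \<Rightarrow> bool" where
  "affine_cong m u v \<longleftrightarrow> (\<forall>x. [affine u x = affine v x] (mod int m))"

lemma affine_mod: "[x = y] (mod n) \<Longrightarrow> [affine u x = affine u y] (mod n)"
  by (subst (1 2) affine_eq) (auto intro: cong_add cong_diff)

lemma word_cong_imp_affine_cong:
  "word_cong (dihedral_relations m) u v \<Longrightarrow> affine_cong m u v"
proof (induction rule: word_cong.induct)
  case (relation u v)
  then show ?case
    by (auto simp: dihedral_relations_def affine_cong_def affine_rotation cong_iff_dvd_diff)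
next
  case (append u u' v v')
  then show ?case
    unfolding affine_cong_def affine_append using affine_mod cong_trans by blast
qed (auto simp: affine_cong_def intro: cong_sym cong_trans)

lemma word_cong_simps:
  "word_cong (dihedral_relations m) [S0, S0] []"
  "word_cong (dihedral_relations m) [S1, S1] []"
  "word_cong (dihedral_relations m) (concat (replicate m [S0, S1])) []"
  by (auto intro!: word_cong.relation simp: dihedral_relations_def)

section \<open>Normal forms of words in the dihedral group\<close>

abbreviation rotation_word :: "nat \<Rightarrow> sgen list" where
  "rotation_word k \<equiv> concat (replicate k [S0, S1])"

lemma rotation_word_add: "rotation_word (k + l) = rotation_word k @ rotation_word l"
  by (simp add: replicate_add)

lemma rotation_word_mod: "word_cong (dihedral_relations m) (rotation_word (k mod m)) (rotation_word k)"
proof -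
  have mult: "word_cong (dihedral_relations m) (rotation_word (m * q)) []" for q
  proof (induction q)
    case (Suc q)
    have "word_cong (dihedral_relations m) (rotation_word m @ rotation_word (m * q)) ([] @ [])"
      by (intro word_cong.append word_cong_simps Suc)
    then show ?case by (simp only: mult_Suc_right rotation_word_add append_Nil)
  qed (simp add: word_cong.reflexive)
  have "word_cong (dihedral_relations m) (rotation_word (m * (k div m)) @ rotation_word (k mod m))
      ([] @ rotation_word (k mod m))"
    by (intro word_cong.append word_cong.reflexive mult)
  then show ?thesis
    unfolding rotation_word_add[symmetric] by (simp add: word_cong.symmetric)
qed

lemma dihedral_normal_form:
  assumes "m > 0"
  obtains k where "k < m" "word_cong (dihedral_relations m) u (rotation_word k)"
  | k where "k < m" "word_cong (dihedral_relations m) u (rotation_word k @ [S0])"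
proof -
  let ?W = "word_cong (dihedral_relations m)"
  have "\<exists>k. ?W u (rotation_word k) \<or> ?W u (rotation_word k @ [S0])"
  proof (induction u rule: rev_induct)
    case Nil
    show ?case by (rule exI[of _ 0]) (simp add: word_cong.reflexive)
  next
    case (snoc x u)
    then obtain k where k: "?W u (rotation_word k) \<or> ?W u (rotation_word k @ [S0])" by blast
    \<comment> \<open>Appending \<open>S1\<close> to a rotation: first insert a full turn, so that
      the rotation word visibly ends in \<open>S0\<close>, \<open>S1\<close> even for k = 0, then
      cancel the two letters \<open>S1\<close>. The subtraction is harmless since m is
      positive.\<close>
    have last: "?W (rotation_word k @ [S1]) (rotation_word (k + m - 1) @ [S0])"
    proof -
      have "?W (rotation_word k) (rotation_word (k + m))"
        using rotation_word_mod[of m k] rotation_word_mod[of m "k + m"]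
        by (auto intro: word_cong.symmetric word_cong.transitive)
      also have "rotation_word (k + m) = rotation_word (k + m - 1) @ [S0, S1]"
        using assms rotation_word_add[of "k + m - 1" 1] by simp
      finally have "?W (rotation_word k @ [S1]) (rotation_word (k + m - 1) @ [S0] @ [S1, S1])"
        using word_cong_append_right[of _ "rotation_word k" _ "[S1]"] by fastforce
      moreover have "?W (rotation_word (k + m - 1) @ [S0] @ [S1, S1])
          (rotation_word (k + m - 1) @ [S0] @ [])"
        by (intro word_cong_append_left word_cong_simps)
      ultimately show ?thesis using word_cong.transitive by fastforce
    qed
    have flip: "?W (rotation_word k @ [S0] @ [S0]) (rotation_word k)"
      using word_cong_append_left[OF word_cong_simps(1), of m "rotation_word k"] by simp
    have next_: "rotation_word k @ [S0] @ [S1] = rotation_word (k + 1)"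
      using rotation_word_add[of k 1] by simp
    from k show ?case
    proof
      assume "?W u (rotation_word k)"
      then have "?W (u @ [x]) (rotation_word k @ [x])" by (rule word_cong_append_right)
      then show ?thesis using last word_cong.transitive by (cases x) blast+
    next
      assume "?W u (rotation_word k @ [S0])"
      then have "?W (u @ [x]) (rotation_word k @ [S0] @ [x])"
        using word_cong_append_right by fastforce
      then show ?thesis using flip next_ word_cong.transitive by (cases x) (blast, metis)
    qed
  qed
  then obtain k where k: "?W u (rotation_word k) \<or> ?W u (rotation_word k @ [S0])" by blast
  then have "?W u (rotation_word (k mod m)) \<or> ?W u (rotation_word (k mod m) @ [S0])"
    using rotation_word_mod[of m k] word_cong.symmetric word_cong.transitive word_cong_append_right by metis
  moreover have "k mod m < m" using assms by simp
  ultimately show ?thesis using that by blast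
qed

text \<open>Faithfulness of the action is checked on normal forms. The value at 0 determines the
  rotation; with equal rotations, the value at 1 separates a rotation from its product with
  \<open>S0\<close>, since otherwise m would divide 2.\<close>

lemma affine_cong_imp_word_cong:
  assumes m: "m \<ge> 3" and uv: "affine_cong m u v"
  shows "word_cong (dihedral_relations m) u v"
proof -
  let ?W = "word_cong (dihedral_relations m)"
  have nf: "\<exists>k b. k < m \<and> ?W u (rotation_word k @ (if b then [S0] else []))" for u
  proof -
    have "m > 0" using m by simp
    then show ?thesis
    proof (cases rule: dihedral_normal_form[of m u])
      case (1 k) then show ?thesis by (intro exI[of _ k] exI[of _ False]) simp
    next
      case (2 k) then show ?thesis by (intro exI[of _ k] exI[of _ True]) simp
    qed
  qed
  obtain k b where k: "k < m" "?W u (rotation_word k @ (if b then [S0] else []))" using nf by blast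
  obtain l c where l: "l < m" "?W v (rotation_word l @ (if c then [S0] else []))" using nf by blast
  have "affine_cong m (rotation_word k @ (if b then [S0] else [])) (rotation_word l @ (if c then [S0] else []))"
    using k(2) l(2) uv word_cong_imp_affine_cong[of m] unfolding affine_cong_def
    by (meson cong_sym cong_trans)
  then have *: "[(if b then - x else x) - int k = (if c then - x else x) - int l] (mod int m)" for x
    unfolding affine_cong_def by (auto simp: affine_append affine_rotation)
  have "[int k = int l] (mod int m)"
    using cong_diff[OF cong_refl[of 0] *[of 0]] by (cases b; cases c) simp_all
  then have kl: "k = l"
    using k(1) l(1) by (simp add: cong_int_iff cong_less_modulus_unique_nat)
  have "b = c"
  proof (rule ccontr)
    assume "b \<noteq> c"
    then have "int m dvd 2"
      using *[of 1] kl by (cases b; cases c) (auto simp: cong_iff_dvd_diff)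
    then show False using m by (auto dest: zdvd_imp_le)
  qed
  then show ?thesis
    using word_cong.transitive[OF k(2)] word_cong.symmetric[OF l(2)] kl by simp
qed

section \<open>The group for odd m, with elements given by words\<close>

locale odd_dihedral =
  fixes m :: nat
  assumes m_ge: "m \<ge> 3" and m_odd: "odd m"
begin

abbreviation "D \<equiv> dihedral m"
abbreviation "cl \<equiv> word_class m"
abbreviation "s \<equiv> reflection m"

lemma cl_eq_iff: "cl u = cl v \<longleftrightarrow> affine_cong m u v"
  unfolding word_class_def Collect_word_cong_eq_iff
  using affine_cong_imp_word_cong[OF m_ge] word_cong_imp_affine_cong by blast

lemma dihedral_simps:
  "carrier D = range cl" "\<one>\<^bsub>D\<^esub> = cl []" "cl u \<otimes>\<^bsub>D\<^esub> cl v = cl (u @ v)"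
proof -
  show "carrier D = range cl" "\<one>\<^bsub>D\<^esub> = cl []"
    by (simp_all add: dihedral_def presented_monoid_def word_class_def[abs_def])
  show "cl u \<otimes>\<^bsub>D\<^esub> cl v = cl (u @ v)"
    by (auto simp: dihedral_def presented_monoid_def word_class_def
        intro: word_cong.reflexive word_cong.append word_cong.transitive)
qed

text \<open>The generators are involutions, so reversing a word inverts it.\<close>

lemma cl_rev: "cl (rev u @ u) = cl []"
  by (simp add: cl_eq_iff affine_cong_def affine_append affine_rev)

sublocale D: group D
proof (rule groupI)
  fix x assume "x \<in> carrier D"
  then obtain u where "x = cl u" by (auto simp: dihedral_simps)
  then show "\<exists>y\<in>carrier D. y \<otimes>\<^bsub>D\<^esub> x = \<one>\<^bsub>D\<^esub>"
    by (intro bexI[of _ "cl (rev u)"]) (auto simp: dihedral_simps cl_rev)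
qed (auto simp: dihedral_simps)

lemma inv_cl: "inv\<^bsub>D\<^esub> cl u = cl (rev u)"
  by (rule D.inv_equality) (auto simp: dihedral_simps cl_rev)

lemma cl_closed [simp]: "cl u \<in> carrier D"
  by (simp add: dihedral_simps)

lemma finite_dihedral: "finite (carrier D)"
proof (rule finite_subset)
  show "carrier D \<subseteq> cl ` (rotation_word ` {..<m} \<union> (\<lambda>k. rotation_word k @ [S0]) ` {..<m})"
  proof
    fix x assume "x \<in> carrier D"
    then obtain u where u: "x = cl u" by (auto simp: dihedral_simps)
    have "m > 0" using m_ge by simp
    then show "x \<in> cl ` (rotation_word ` {..<m} \<union> (\<lambda>k. rotation_word k @ [S0]) ` {..<m})"
      by (cases rule: dihedral_normal_form[of m u])
        (auto simp: u word_class_def Collect_word_cong_eq_iff intro!: image_eqI)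
  qed
qed auto

lemma s_closed [simp]: "s i \<in> carrier D"
  by (simp add: reflection_def)

lemma s_square: "s i \<otimes>\<^bsub>D\<^esub> s i = \<one>\<^bsub>D\<^esub>"
  unfolding reflection_def using cl_rev[of "reflection_word i"]
  by (simp add: dihedral_simps rev_reflection_word)

lemma inv_s [simp]: "inv\<^bsub>D\<^esub> s i = s i"
  by (rule D.inv_equality) (simp_all add: s_square)

lemma s_eq_iff: "i < m \<Longrightarrow> j < m \<Longrightarrow> s i = s j \<longleftrightarrow> i = j"
  by (auto simp: reflection_def cl_eq_iff affine_cong_def affine_reflection_word cong_int_iff
      cong_less_modulus_unique_nat dest!: spec[of _ 0])

section \<open>The conjugation action on indices of reflections\<close>

definition act :: "sgen list set \<Rightarrow> nat \<Rightarrow> nat" where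
  "act w i = (THE k. k < m \<and> w \<otimes>\<^bsub>D\<^esub> s i = s k \<otimes>\<^bsub>D\<^esub> w)"

text \<open>If u acts as x -> a + cx with c = 1 or c = -1, then conjugating x -> i - x by u gives x
  -> (2a + ci) - x, and 2a + ci is the sum of the values of u at 0 and at i. Its residue modulo m is
  the new index.\<close>

lemma act_cl_ex:
  "cl u \<otimes>\<^bsub>D\<^esub> s i = s (nat ((affine u 0 + affine u (int i)) mod int m)) \<otimes>\<^bsub>D\<^esub> cl u"
proof -
  have "[affine u (int i - x)
      = (affine u 0 + affine u (int i)) mod int m - affine u x] (mod int m)" for x
  proof -
    have "affine u (int i - x) = affine u 0 + affine u (int i) - affine u x"
      using affine_eq[of u "int i - x"] affine_eq[of u "int i"] affine_eq[of u x] by (auto split: if_splits)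
    then show ?thesis
      by (metis cong_diff cong_mod_right cong_refl)
  qed
  moreover have "(affine u 0 + affine u (int i)) mod int m \<ge> 0"
    using m_ge by simp
  ultimately show ?thesis
    by (simp add: reflection_def dihedral_simps cl_eq_iff affine_cong_def affine_append affine_reflection_word)
qed

lemma act_unique:
  assumes "w \<in> carrier D" "k < m" "w \<otimes>\<^bsub>D\<^esub> s i = s k \<otimes>\<^bsub>D\<^esub> w"
  shows "act w i = k"
  unfolding act_def
proof (rule the_equality)
  fix l assume "l < m \<and> w \<otimes>\<^bsub>D\<^esub> s i = s l \<otimes>\<^bsub>D\<^esub> w"
  then have "s l = s k" using assms by simp
  then show "l = k" using \<open>l < m \<and> _\<close> assms s_eq_iff by simp
qed (use assms in simp)

lemma act_cl: "act (cl u) i = nat ((affine u 0 + affine u (int i)) mod int m)"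
  using m_ge by (intro act_unique act_cl_ex) (simp_all add: nat_less_iff)

lemma act_less: "w \<in> carrier D \<Longrightarrow> act w i < m"
  using m_ge by (auto simp: dihedral_simps act_cl nat_less_iff)

lemma act_commute: "w \<in> carrier D \<Longrightarrow> w \<otimes>\<^bsub>D\<^esub> s i = s (act w i) \<otimes>\<^bsub>D\<^esub> w"
  using act_cl_ex act_cl by (auto simp: dihedral_simps(1))

lemma act_eq_iff:
  assumes "w \<in> carrier D" "k < m"
  shows "act w i = k \<longleftrightarrow> w \<otimes>\<^bsub>D\<^esub> s i \<otimes>\<^bsub>D\<^esub> inv\<^bsub>D\<^esub> w = s k"
proof -
  have "act w i = k \<longleftrightarrow> w \<otimes>\<^bsub>D\<^esub> s i = s k \<otimes>\<^bsub>D\<^esub> w"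
    using act_unique act_commute assms by blast
  also have "\<dots> \<longleftrightarrow> w \<otimes>\<^bsub>D\<^esub> s i \<otimes>\<^bsub>D\<^esub> inv\<^bsub>D\<^esub> w = s k"
    using assms by (metis D.inv_solve_right D.m_closed s_closed)
  finally show ?thesis .
qed

lemma act_one: "i < m \<Longrightarrow> act \<one>\<^bsub>D\<^esub> i = i"
  by (intro act_unique) auto

lemma act_mult:
  assumes "v \<in> carrier D" "w \<in> carrier D"
  shows "act (v \<otimes>\<^bsub>D\<^esub> w) i = act v (act w i)"
proof (rule act_unique)
  have "v \<otimes>\<^bsub>D\<^esub> w \<otimes>\<^bsub>D\<^esub> s i = v \<otimes>\<^bsub>D\<^esub> (s (act w i) \<otimes>\<^bsub>D\<^esub> w)"
    using assms act_commute[of w i] by (simp add: D.m_assoc)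
  also have "\<dots> = v \<otimes>\<^bsub>D\<^esub> s (act w i) \<otimes>\<^bsub>D\<^esub> w" using assms by (simp add: D.m_assoc)
  also have "\<dots> = s (act v (act w i)) \<otimes>\<^bsub>D\<^esub> (v \<otimes>\<^bsub>D\<^esub> w)"
    using assms act_commute[of v] by (simp add: D.m_assoc)
  finally show "v \<otimes>\<^bsub>D\<^esub> w \<otimes>\<^bsub>D\<^esub> s i = s (act v (act w i)) \<otimes>\<^bsub>D\<^esub> (v \<otimes>\<^bsub>D\<^esub> w)" .
qed (use assms act_less in auto)

lemma act_inv: "w \<in> carrier D \<Longrightarrow> i < m \<Longrightarrow> act (inv\<^bsub>D\<^esub> w) (act w i) = i"
  "w \<in> carrier D \<Longrightarrow> i < m \<Longrightarrow> act w (act (inv\<^bsub>D\<^esub> w) i) = i"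
  by (simp_all flip: act_mult add: act_one)

lemma act_s: "act (s k) j = nat ((2 * int k - int j) mod int m)"
  by (simp add: reflection_def act_cl affine_reflection_word)

text \<open>A word of even length acts as x -> x + a, one of odd length as x -> a - x. Fixing j
  means 2a = 0 or 2a = 2j modulo m, and cancelling 2, possible for odd m, leaves a = 0 or a =
  j.\<close>

lemma act_stabilizer:
  assumes w: "w \<in> carrier D" and j: "j < m" and stab: "act w j = j"
  shows "w = \<one>\<^bsub>D\<^esub> \<or> w = s j"
proof -
  obtain u where u: "w = cl u" using w by (auto simp: dihedral_simps)
  have "int j = (affine u 0 + affine u (int j)) mod int m"
    using stab m_ge pos_mod_sign[of "int m"] unfolding u act_cl by (simp add: nat_eq_iff)
  then have c: "[affine u 0 + affine u (int j) = int j] (mod int m)"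
    by (metis cong_mod_right cong_refl)
  have two: "int m dvd x" if "int m dvd 2 * x" for x
    using that m_odd by (metis coprime_dvd_mult_right_iff coprime_left_2_iff_odd coprime_commute even_of_nat)
  show ?thesis
  proof (cases "even (length u)")
    case True
    with c affine_eq[of u "int j"] have "int m dvd 2 * affine u 0"
      by (simp add: cong_iff_dvd_diff)
    from two[OF this] have "[affine u x = x] (mod int m)" for x
      using affine_eq[of u x] True by (simp add: cong_iff_dvd_diff)
    then have "affine_cong m u []" by (simp add: affine_cong_def)
    then show ?thesis by (simp add: u dihedral_simps cl_eq_iff)
  next
    case False
    with c affine_eq[of u "int j"] have "int m dvd 2 * (affine u 0 - int j)"
      by (simp add: cong_iff_dvd_diff algebra_simps)
    from two[OF this] have "[affine u x = int j - x] (mod int m)" for x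
      using affine_eq[of u x] False by (simp add: cong_iff_dvd_diff)
    then have "affine_cong m u (reflection_word j)"
      by (simp add: affine_cong_def affine_reflection_word)
    then show ?thesis by (simp add: u reflection_def cl_eq_iff)
  qed
qed

lemma conj_index:
  assumes "i < m" "j < m"
  shows "conj_index m i j < m" "act (s (conj_index m i j)) j = i"
proof -
  have iff: "s k \<otimes>\<^bsub>D\<^esub> s j \<otimes>\<^bsub>D\<^esub> s k = s i \<longleftrightarrow> [2 * int k - int j = int i] (mod int m)" for k
  proof -
    have "s k \<otimes>\<^bsub>D\<^esub> s j \<otimes>\<^bsub>D\<^esub> s k = s i \<longleftrightarrow> act (s k) j = i"
      using act_eq_iff[of "s k" i j] assms by simp
    also have "\<dots> \<longleftrightarrow> (2 * int k - int j) mod int m = int i mod int m"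
      using assms m_ge by (auto simp: act_s nat_eq_iff)
    finally show ?thesis by (simp add: cong_def)
  qed
  \<comment> \<open>The number (m + 1)/2 is the inverse of 2 modulo m, so k solves 2k - j =
    i.\<close>
  define k where "k = (i + j) * ((m + 1) div 2) mod m"
  have "2 * ((i + j) * ((m + 1) div 2)) = (i + j) * (m + 1)"
    using m_odd by (metis dvd_mult_div_cancel even_add mult.assoc mult.left_commute odd_one)
  then have "[2 * k = i + j] (mod m)"
    unfolding k_def cong_def by (metis add.commute mod_mult_right_eq mod_mult_self2 mult.commute mult_Suc_right plus_1_eq_Suc)
  then have k: "[2 * int k - int j = int i] (mod int m)"
    by (metis add_diff_cancel_right' cong_diff cong_int_iff cong_refl of_nat_add of_nat_mult of_nat_numeral)
  have unique: "l = k" if "l < m" "[2 * int l - int j = int i] (mod int m)" for l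
  proof -
    have "[2 * int l = 2 * int k] (mod int m)"
      using that(2) k cong_add[OF cong_trans[OF that(2) cong_sym[OF k]] cong_refl[of "int j"]] by simp
    then have "[int l = int k] (mod int m)"
      using m_odd by (subst (asm) cong_mult_lcancel) auto
    then show ?thesis
      using that(1) by (simp add: cong_int_iff k_def cong_def)
  qed
  have "conj_index m i j = k"
    unfolding conj_index_def iff
    using k unique m_ge by (intro the_equality) (auto simp: k_def)
  then show "conj_index m i j < m" "act (s (conj_index m i j)) j = i"
    using k iff act_eq_iff[of "s k" i j] assms m_ge by (auto simp: k_def)
qed

end

section \<open>A twisted monoid on the cell basis\<close>

datatype cell = Grp "sgen list set" | Kr nat nat

locale brauer = odd_dihedral m for m :: nat + fixes \<tau> :: complex
begin

definition cells :: "cell set" where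
  "cells = Grp ` carrier D \<union> (\<lambda>(i, j). Kr i j) ` ({..<m} \<times> {..<m})"

text \<open>The multiplication table without its scalars, which are kept in \<open>twist\<close>.
  Matrix units multiply as in a rectangular band. A group element on the right moves the column
  index by its inverse, because e(j) w = w e(k) with k = \<open>act (inv w) j\<close>.\<close>

fun cmul :: "cell \<Rightarrow> cell \<Rightarrow> cell" where
  "cmul (Grp v) (Grp w) = Grp (v \<otimes>\<^bsub>D\<^esub> w)"
| "cmul (Grp v) (Kr i j) = Kr (act v i) j"
| "cmul (Kr i j) (Grp w) = Kr i (act (inv\<^bsub>D\<^esub> w) j)"
| "cmul (Kr i j) (Kr k l) = Kr i l"

fun twist :: "cell \<Rightarrow> cell \<Rightarrow> complex" where
  "twist (Kr i j) (Kr k l) = (if j = k then \<tau> else 1)"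
| "twist _ _ = 1"

fun cstar :: "cell \<Rightarrow> cell" where
  "cstar (Grp w) = Grp (inv\<^bsub>D\<^esub> w)"
| "cstar (Kr i j) = Kr j i"

lemma cells_iff [simp]:
  "Grp w \<in> cells \<longleftrightarrow> w \<in> carrier D" "Kr i j \<in> cells \<longleftrightarrow> i < m \<and> j < m"
  by (auto simp: cells_def)

lemma finite_cells: "finite cells"
  by (simp add: cells_def finite_dihedral)

lemma cmul_closed: "a \<in> cells \<Longrightarrow> b \<in> cells \<Longrightarrow> cmul a b \<in> cells"
  by (cases a; cases b) (auto simp: act_less)

lemma cmul_assoc:
  "\<lbrakk>a \<in> cells; b \<in> cells; c \<in> cells\<rbrakk> \<Longrightarrow> cmul (cmul a b) c = cmul a (cmul b c)"
  by (cases a; cases b; cases c) (auto simp: D.m_assoc act_mult D.inv_mult_group)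

text \<open>The cocycle identity that makes the twisted multiplication associative. The case with
  content is \<open>Kr\<close>, \<open>Grp\<close>, \<open>Kr\<close>: there j equals w k exactly if
  the inverse of w maps j to k.\<close>

lemma twist_assoc:
  "\<lbrakk>a \<in> cells; b \<in> cells; c \<in> cells\<rbrakk>
    \<Longrightarrow> twist a b * twist (cmul a b) c = twist b c * twist a (cmul b c)"
  by (cases a; cases b; cases c) (auto simp: act_inv)

lemma cmul_one: "a \<in> cells \<Longrightarrow> cmul (Grp \<one>\<^bsub>D\<^esub>) a = a" "a \<in> cells \<Longrightarrow> cmul a (Grp \<one>\<^bsub>D\<^esub>) = a"
  by (cases a; simp add: act_one)+

lemma twist_Grp [simp]: "twist (Grp w) a = 1" "twist a (Grp w) = 1"
  by (cases a; simp)+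

lemma cstar_closed: "a \<in> cells \<Longrightarrow> cstar a \<in> cells"
  by (cases a) auto

lemma cstar_cstar: "a \<in> cells \<Longrightarrow> cstar (cstar a) = a"
  by (cases a) auto

lemma cmul_cstar:
  "\<lbrakk>a \<in> cells; b \<in> cells\<rbrakk> \<Longrightarrow> cmul (cstar a) (cstar b) = cstar (cmul b a)"
  by (cases a; cases b) (auto simp: D.inv_mult_group)

lemma twist_cstar: "twist (cstar a) (cstar b) = twist b a"
  by (cases a; cases b) auto

abbreviation "X \<equiv> brauer_gens m"
abbreviation "R \<equiv> brauer_relations m \<tau>"
abbreviation "B \<equiv> brauer_algebra m \<tau>"
abbreviation "bw \<equiv> brauer_word m \<tau>"
abbreviation "FX \<equiv> free_algebra X"

section \<open>Evaluation of words in the twisted monoid\<close>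

fun gen :: "bgen \<Rightarrow> cell" where
  "gen (Refl x) = Grp (cl [x])"
| "gen (E i) = Kr i i"

text \<open>The cell of a word stays defined even when its scalar \<open>scal\<close> vanishes, as
  can happen for \<tau> = 0. Hence \<open>cmul\<close> is a total monoid operation and no zero
  element has to be adjoined.\<close>

fun nf :: "bgen list \<Rightarrow> cell" where
  "nf [] = Grp \<one>\<^bsub>D\<^esub>"
| "nf (x # u) = cmul (gen x) (nf u)"

fun scal :: "bgen list \<Rightarrow> complex" where
  "scal [] = 1"
| "scal (x # u) = twist (gen x) (nf u) * scal u"

lemma X_iff [simp]: "Refl x \<in> X" "E i \<in> X \<longleftrightarrow> i < m"
  by (auto simp: brauer_gens_def)

lemma gword_X [simp]: "gword u \<in> lists X"
  by (auto simp: brauer_gens_def)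

lemma gen_closed: "x \<in> X \<Longrightarrow> gen x \<in> cells"
  by (cases x) auto

lemma nf_closed: "u \<in> lists X \<Longrightarrow> nf u \<in> cells"
  by (induction u) (auto simp: gen_closed cmul_closed)

lemma nf_append: "u \<in> lists X \<Longrightarrow> v \<in> lists X \<Longrightarrow> nf (u @ v) = cmul (nf u) (nf v)"
  by (induction u) (auto simp: cmul_one nf_closed cmul_assoc gen_closed in_listsI)

lemma scal_append:
  "u \<in> lists X \<Longrightarrow> v \<in> lists X \<Longrightarrow> scal (u @ v) = scal u * scal v * twist (nf u) (nf v)"
proof (induction u)
  case (Cons x u)
  then have c: "x \<in> X" "u \<in> lists X" by auto
  then have "twist (gen x) (nf u) * twist (nf (x # u)) (nf v)
      = twist (nf u) (nf v) * twist (gen x) (cmul (nf u) (nf v))"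
    using Cons.prems by (simp add: twist_assoc gen_closed nf_closed)
  then show ?case
    using Cons c by (simp add: nf_append mult_ac)
qed simp

lemma nf_gword: "nf (gword u) = Grp (cl u)"
  by (induction u) (auto simp: dihedral_simps)

lemma scal_gword: "scal (gword u) = 1"
  by (induction u) (auto simp: nf_gword)

lemma nf_sword: "nf (sword i) = Grp (s i)"
  by (simp add: nf_gword reflection_def)

lemma act_s_self: "i < m \<Longrightarrow> act (s i) i = i"
  by (intro act_unique) auto

text \<open>The consistency check of the presentation. Both sides of a relation are monomials, so it
  is enough to compare one cell and one scalar. The coefficient on the right differs from 1 only for
  \<open>e_square\<close>, where it balances the twist.\<close>

lemma relations_normal_form:
  assumes "(p, q) \<in> R"
  shows "\<exists>u v c d. p = monomial c u \<and> q = monomial d v \<and> u \<in> lists X \<and> v \<in> lists X \<and>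
    nf u = nf v \<and> c * scal u = d * scal v"
  using assms
proof cases
  case braid
  have "concat (replicate k [Refl S0, Refl S1]) = gword (rotation_word k)" for k
    by (induction k) auto
  moreover have "cl (rotation_word m) = cl []"
    by (simp add: cl_eq_iff word_cong_imp_affine_cong word_cong_simps)
  ultimately show ?thesis
    using braid gword_X[of "rotation_word m"]
    by (intro exI[of _ "gword (rotation_word m)"] exI[of _ "[]"] exI[of _ "1::complex"])
      (simp add: nf_gword scal_gword dihedral_simps del: map_concat map_replicate)
next
  case s0_square
  have "cl [S0, S0] = cl []" by (simp add: cl_eq_iff word_cong_imp_affine_cong word_cong_simps)
  with s0_square show ?thesis
    by (intro exI[of _ "gword [S0, S0]"] exI[of _ "[]"] exI[of _ "1::complex"])
      (simp add: dihedral_simps)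
next
  case s1_square
  have "cl [S1, S1] = cl []" by (simp add: cl_eq_iff word_cong_imp_affine_cong word_cong_simps)
  with s1_square show ?thesis
    by (intro exI[of _ "gword [S1, S1]"] exI[of _ "[]"] exI[of _ "1::complex"])
      (simp add: dihedral_simps)
next
  case (s_e i)
  then show ?thesis
    by (intro exI[of _ "sword i @ [E i]"] exI[of _ "[E i]"] exI[of _ "1::complex"])
      (simp add: nf_append scal_append nf_sword scal_gword act_s_self act_one)
next
  case (e_s i)
  then show ?thesis
    by (intro exI[of _ "[E i] @ sword i"] exI[of _ "[E i]"] exI[of _ "1::complex"])
      (simp add: nf_sword scal_gword act_s_self act_one)
next
  case (transport i j u)
  then have "act (cl u) i = j" by (intro act_unique) auto
  with transport act_inv(1)[of "cl u" i] show ?thesis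
    by (intro exI[of _ "gword u @ [E i]"] exI[of _ "[E j] @ gword u"] exI[of _ "1::complex"])
      (simp add: nf_append scal_append nf_gword scal_gword act_one)
next
  case (e_square i)
  then show ?thesis
    by (intro exI[of _ "[E i, E i]"] exI[of _ "[E i]"] exI[of _ "1::complex"] exI[of _ \<tau>])
      (simp add: act_one)
next
  case (e_e_left i j)
  then show ?thesis using conj_index[of i j]
    by (intro exI[of _ "[E i, E j]"] exI[of _ "sword (conj_index m i j) @ [E j]"] exI[of _ "1::complex"])
      (simp add: nf_append scal_append nf_sword scal_gword act_one)
next
  case (e_e_right i j)
  \<comment> \<open>The reflection exchanges i and j, being its own inverse.\<close>
  then have "act (s (conj_index m i j)) i = j"
    using conj_index[of i j] act_inv(1)[of "s (conj_index m i j)" j] by simp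
  with e_e_right show ?thesis
    by (intro exI[of _ "[E i, E j]"] exI[of _ "[E i] @ sword (conj_index m i j)"] exI[of _ "1::complex"])
      (simp add: nf_sword scal_gword act_one)
qed

sublocale algebra_presentation X R
proof
  fix p q assume "(p, q) \<in> R"
  from relations_normal_form[OF this]
  show "p \<in> carrier FX \<and> q \<in> carrier FX" by (auto intro: monomial_closed)
qed

section \<open>Coordinates on the Brauer algebra\<close>

definition coef :: "cell \<Rightarrow> bgen list \<Rightarrow> complex" where
  "coef b u = (if nf u = b then scal u else 0)"

text \<open>The largest two-sided ideal on which all coordinates vanish.\<close>

definition annihilator :: "(bgen list \<Rightarrow> complex) set" where
  "annihilator = {f \<in> carrier FX.
     \<forall>u\<in>lists X. \<forall>v\<in>lists X. \<forall>b. pairing f (\<lambda>w. coef b (u @ w @ v)) = 0}"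

lemma finite_support: "f \<in> carrier FX \<Longrightarrow> finite {x. f x \<noteq> 0}"
  by (simp add: monoid_algebra_simps)

lemma support_lists: "f \<in> carrier FX \<Longrightarrow> f u \<noteq> 0 \<Longrightarrow> u \<in> lists X"
  by (auto simp: monoid_algebra_simps)

lemma pairing_add: "f \<in> carrier FX \<Longrightarrow> g \<in> carrier FX
    \<Longrightarrow> pairing (f \<oplus>\<^bsub>FX\<^esub> g) \<phi> = pairing f \<phi> + pairing g \<phi>"
  by (simp add: monoid_algebra_simps pairing_add_left)

lemma pairing_zero: "pairing \<zero>\<^bsub>FX\<^esub> \<phi> = 0"
  by (simp add: monoid_algebra_simps)

lemma pairing_neg: "f \<in> carrier FX \<Longrightarrow> pairing (\<ominus>\<^bsub>FX\<^esub> f) \<phi> = - pairing f \<phi>"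
  using pairing_add[of f "\<ominus>\<^bsub>FX\<^esub> f" \<phi>] by (simp add: F.r_neg pairing_zero eq_neg_iff_add_eq_0 add.commute)

lemma pairing_minus: "f \<in> carrier FX \<Longrightarrow> g \<in> carrier FX
    \<Longrightarrow> pairing (f \<ominus>\<^bsub>FX\<^esub> g) \<phi> = pairing f \<phi> - pairing g \<phi>"
  by (simp add: F.minus_eq pairing_add pairing_neg)

text \<open>Multiplication by g only lengthens the context: its words join u or v. For a factor on
  the right, the two summations are exchanged first, so that the pairing with f becomes the inner
  one.\<close>

lemma annihilator_ideal: "ideal annihilator FX"
proof (rule idealI)
  show "ring FX" by (rule F.ring_axioms)
  show "subgroup annihilator (add_monoid FX)"
    by unfold_locales
      (auto simp: annihilator_def pairing_add pairing_zero pairing_neg simp flip: a_inv_def)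
  fix f g assume f: "f \<in> annihilator" and g: "g \<in> carrier FX"
  then have fc: "f \<in> carrier FX" by (simp add: annihilator_def)
  have "pairing g (\<lambda>y. pairing f (\<lambda>z. coef b (u @ (y @ z) @ v))) = pairing g (\<lambda>y. 0)"
    if uv: "u \<in> lists X" "v \<in> lists X" for u v b
  proof (intro pairing_cong)
    fix y assume "g y \<noteq> 0"
    then have "u @ y \<in> lists X" using uv support_lists[OF g] by auto
    then have "pairing f (\<lambda>z. coef b ((u @ y) @ z @ v)) = 0"
      using f uv unfolding annihilator_def by blast
    then show "pairing f (\<lambda>z. coef b (u @ (y @ z) @ v)) = 0" by simp
  qed
  then show "g \<otimes>\<^bsub>FX\<^esub> f \<in> annihilator"
    using fc g by (simp add: annihilator_def pairing_mult finite_support)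
  have "pairing f (\<lambda>y. pairing g (\<lambda>z. coef b (u @ (y @ z) @ v))) = 0"
    if uv: "u \<in> lists X" "v \<in> lists X" for u v b
  proof -
    have "pairing f (\<lambda>y. pairing g (\<lambda>z. coef b (u @ (y @ z) @ v)))
        = (\<Sum>z | g z \<noteq> 0. pairing f (\<lambda>y. g z * coef b (u @ y @ z @ v)))"
      unfolding pairing_sum_right[symmetric] by (simp add: pairing_def)
    also have "\<dots> = 0"
      using f uv support_lists[OF g]
      by (intro sum.neutral) (auto simp: pairing_scale_right annihilator_def)
    finally show ?thesis .
  qed
  then show "f \<otimes>\<^bsub>FX\<^esub> g \<in> annihilator"
    using fc g by (simp add: annihilator_def pairing_mult finite_support)
qed

text \<open>By \<open>nf_append\<close> and \<open>scal_append\<close>, the word x u y depends on u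
  only through \<open>nf u\<close> and is linear in \<open>scal u\<close>. Relators therefore vanish
  in every context, and minimality of the generated ideal does the rest. All linear independence in
  the algebra rests on this inclusion.\<close>

lemma relation_ideal_annihilator: "I \<subseteq> annihilator"
  unfolding relation_ideal_def
proof (rule F.genideal_minimal[OF annihilator_ideal], clarify)
  fix p q assume "(p, q) \<in> R"
  from relations_normal_form[OF this] obtain u v c d where
    *: "p = monomial c u" "q = monomial d v" "u \<in> lists X" "v \<in> lists X"
      "nf u = nf v" "c * scal u = d * scal v" by blast
  have "pairing (p \<ominus>\<^bsub>FX\<^esub> q) (\<lambda>w. coef b (x @ w @ y)) = 0"
    if "x \<in> lists X" "y \<in> lists X" for x y b
  proof -
    have "c * coef b (x @ u @ y) = d * coef b (x @ v @ y)"
      using * that by (simp add: coef_def nf_append scal_append)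
    then show ?thesis using * by (simp add: pairing_minus monomial_closed)
  qed
  then show "p \<ominus>\<^bsub>FX\<^esub> q \<in> annihilator"
    using * by (simp add: annihilator_def monomial_closed)
qed

section \<open>Coordinates of elements of the quotient\<close>

definition coord :: "(bgen list \<Rightarrow> complex) set \<Rightarrow> cell \<Rightarrow> complex" where
  "coord P b = pairing (SOME p. p \<in> P) (coef b)"

lemma coord_proj:
  assumes "p \<in> carrier FX"
  shows "coord (proj p) b = pairing p (coef b)"
proof -
  define q where "q = (SOME q. q \<in> proj p)"
  have "q \<in> proj p" unfolding q_def by (rule someI[of "\<lambda>q. q \<in> proj p", OF proj_self[OF assms]])
  then have q: "q \<in> carrier FX" "q \<ominus>\<^bsub>FX\<^esub> p \<in> I"
    using proj_memD[OF assms] assms proj_eq_iff by auto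
  \<comment> \<open>The context of two empty words turns membership in \<open>annihilator\<close>
    into equality of the coordinates themselves.\<close>
  then have "pairing (q \<ominus>\<^bsub>FX\<^esub> p) (\<lambda>w. coef b ([] @ w @ [])) = 0"
    using relation_ideal_annihilator unfolding annihilator_def by blast
  then have "pairing q (coef b) = pairing p (coef b)"
    using pairing_minus[OF q(1) assms] by simp
  then show ?thesis by (simp add: coord_def q_def)
qed

lemmas B_simps = presented_algebra_simps[folded brauer_algebra_def]

sublocale B: complex_algebra B
  unfolding brauer_algebra_def by (rule complex_algebra_presented)

lemma coord_add: "P \<in> carrier B \<Longrightarrow> Q \<in> carrier B \<Longrightarrow> coord (P \<oplus>\<^bsub>B\<^esub> Q) b = coord P b + coord Q b"
  by (auto simp: B_simps coord_proj pairing_add)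

lemma coord_smult: "P \<in> carrier B \<Longrightarrow> coord (c \<odot>\<^bsub>B\<^esub> P) b = c * coord P b"
  by (auto simp: B_simps proj_smult[folded brauer_algebra_def] coord_proj)
    (simp add: monoid_algebra_simps pairing_scale_left)

lemma coord_zero: "coord \<zero>\<^bsub>B\<^esub> b = 0"
  by (simp add: B_simps coord_proj pairing_zero)

lemma coord_neg: "P \<in> carrier B \<Longrightarrow> coord (\<ominus>\<^bsub>B\<^esub> P) b = - coord P b"
  using coord_add[of P "\<ominus>\<^bsub>B\<^esub> P" b] by (simp add: B.r_neg coord_zero eq_neg_iff_add_eq_0 add.commute)

lemma coord_minus:
  "P \<in> carrier B \<Longrightarrow> Q \<in> carrier B \<Longrightarrow> coord (P \<ominus>\<^bsub>B\<^esub> Q) b = coord P b - coord Q b"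
  by (simp add: B.minus_eq coord_add coord_neg)

lemma coord_finsum:
  "finite S \<Longrightarrow> f \<in> S \<rightarrow> carrier B \<Longrightarrow> coord (finsum B f S) b = (\<Sum>x\<in>S. coord (f x) b)"
  by (induction S rule: finite_induct) (auto simp: coord_zero coord_add Pi_iff)

lemma sum_coef:
  assumes "u \<in> lists X"
  shows "(\<Sum>a\<in>cells. k a * coef a u) = k (nf u) * scal u"
proof -
  have "(\<Sum>a\<in>cells. k a * coef a u) = (\<Sum>a\<in>cells. if a = nf u then k a * scal u else 0)"
    by (intro sum.cong) (auto simp: coef_def)
  then show ?thesis using assms by (simp add: finite_cells nf_closed)
qed

text \<open>Both sides are bilinear, and on a pair of words the identity is \<open>nf_append\<close>
  together with \<open>scal_append\<close>, since a word has a coordinate at the single cell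
  \<open>nf u\<close> only.\<close>

lemma coord_mult:
  assumes "P \<in> carrier B" "Q \<in> carrier B"
  shows "coord (P \<otimes>\<^bsub>B\<^esub> Q) b
    = (\<Sum>a\<in>cells. \<Sum>c\<in>cells. (if cmul a c = b then twist a c else 0) * (coord P a * coord Q c))"
proof -
  obtain p q where pq: "p \<in> carrier FX" "q \<in> carrier FX" "P = proj p" "Q = proj q"
    using assms by (auto simp: B_simps)
  have *: "coef b (u @ v) = (\<Sum>a\<in>cells. \<Sum>c\<in>cells.
      (if cmul a c = b then twist a c else 0) * coef c v * coef a u)"
    if "u \<in> lists X" "v \<in> lists X" for u v
  proof -
    have "(\<Sum>a\<in>cells. \<Sum>c\<in>cells. (if cmul a c = b then twist a c else 0) * coef c v * coef a u)
        = (if cmul (nf u) (nf v) = b then twist (nf u) (nf v) else 0) * scal v * scal u"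
      using that by (simp add: sum_coef flip: sum_distrib_right)
    then show ?thesis
      using that by (simp add: coef_def nf_append scal_append)
  qed
  have "coord (P \<otimes>\<^bsub>B\<^esub> Q) b = pairing p (\<lambda>u. pairing q (\<lambda>v. coef b (u @ v)))"
    using pq by (simp add: B_simps coord_proj pairing_mult finite_support)
  also have "\<dots> = pairing p (\<lambda>u. pairing q (\<lambda>v. \<Sum>a\<in>cells. \<Sum>c\<in>cells.
      (if cmul a c = b then twist a c else 0) * coef c v * coef a u))"
    by (intro pairing_cong *) (use pq support_lists in blast)+
  also have "\<dots> = (\<Sum>a\<in>cells. \<Sum>c\<in>cells. (if cmul a c = b then twist a c else 0) *
      (pairing p (coef a) * pairing q (coef c)))"
    unfolding pairing_sum_right pairing_product ..
  finally show ?thesis using pq by (simp add: coord_proj)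
qed

section \<open>The cell basis\<close>

lemma bw_eq: "bw u = proj (monomial 1 u)"
  by (simp add: brauer_word_def proj_def)

lemma bw_closed [simp]: "u \<in> lists X \<Longrightarrow> bw u \<in> carrier B"
  by (simp add: bw_eq B_simps monomial_closed)

lemma bw_mult: "u \<in> lists X \<Longrightarrow> v \<in> lists X \<Longrightarrow> bw u \<otimes>\<^bsub>B\<^esub> bw v = bw (u @ v)"
  using monomial_mult[of u X v 1 1] by (simp add: bw_eq B_simps monomial_closed)

lemma bw_relation: "(monomial 1 u, monomial 1 v) \<in> R \<Longrightarrow> bw u = bw v"
  unfolding bw_eq by (rule proj_relation)

lemma coord_bw: "u \<in> lists X \<Longrightarrow> coord (bw u) b = coef b u"
  by (simp add: bw_eq coord_proj monomial_closed)

text \<open>The dihedral relations occur among the Brauer relations. This makes the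
  \<open>the_elem\<close> in \<open>brauer_of_group\<close> refer to a genuine singleton.\<close>

lemma bw_gword_cong:
  assumes "word_cong (dihedral_relations m) u v"
  shows "bw (gword u) = bw (gword v)"
  using assms
proof (induction rule: word_cong.induct)
  case (relation u v)
  have "map Refl (rotation_word m) = concat (replicate m [Refl S0, Refl S1])"
    by (simp add: map_concat)
  with relation have "(monomial 1 (gword u), monomial 1 (gword v)) \<in> R"
    using brauer_relations.intros(1-3)[of m \<tau>] by (auto simp: dihedral_relations_def)
  then show ?case by (rule bw_relation)
next
  case (append u u' v v')
  have "bw (gword u) \<otimes>\<^bsub>B\<^esub> bw (gword v) = bw (gword u') \<otimes>\<^bsub>B\<^esub> bw (gword v')"
    by (simp only: append.IH)
  then show ?case by (simp only: bw_mult gword_X map_append)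
qed auto

lemma bw_gword_eq: "cl u = cl v \<Longrightarrow> bw (gword u) = bw (gword v)"
  by (rule bw_gword_cong) (simp add: word_class_def Collect_word_cong_eq_iff)

lemma brauer_of_group_cl: "brauer_of_group m \<tau> (cl u) = bw (gword u)"
proof -
  have "(\<lambda>v. bw (gword v)) ` cl u = {bw (gword u)}"
    using bw_gword_cong[THEN sym] by (auto simp: word_class_def intro!: word_cong.reflexive)
  then show ?thesis by (simp add: brauer_of_group_def)
qed

lemma bw_s_e: "i < m \<Longrightarrow> bw (sword i @ [E i]) = bw [E i]"
  by (intro bw_relation brauer_relations.s_e)

lemma bw_transport:
  assumes "i < m"
  shows "bw (gword u @ [E i]) = bw ([E (act (cl u) i)] @ gword u)"
  using assms act_less by (intro bw_relation brauer_relations.transport act_commute) auto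

text \<open>The word \<open>rev v @ u\<close> represents the quotient of the two group elements. It
  fixes j, so \<open>act_stabilizer\<close> leaves two cases, and \<open>bw_s_e\<close> absorbs the
  reflection in the second.\<close>

lemma bw_kr_eq:
  assumes "j < m" "act (cl u) j = act (cl v) j"
  shows "bw (gword u @ [E j]) = bw (gword v @ [E j])"
proof -
  have "cl (rev v @ u) = inv\<^bsub>D\<^esub> cl v \<otimes>\<^bsub>D\<^esub> cl u"
    by (simp add: inv_cl dihedral_simps)
  then have "act (cl (rev v @ u)) j = j"
    using assms by (simp add: act_mult act_inv)
  then have cases: "cl (rev v @ u) = \<one>\<^bsub>D\<^esub> \<or> cl (rev v @ u) = s j"
    using assms by (intro act_stabilizer) auto
  have u: "cl u = cl v \<otimes>\<^bsub>D\<^esub> cl (rev v @ u)"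
    using affine_rev[of "rev v"] by (simp add: dihedral_simps cl_eq_iff affine_cong_def affine_append)
  from cases show ?thesis
  proof
    assume "cl (rev v @ u) = \<one>\<^bsub>D\<^esub>"
    then have "cl u = cl v" using u by simp
    from bw_gword_eq[OF this] show ?thesis
      using assms by (simp flip: bw_mult)
  next
    assume "cl (rev v @ u) = s j"
    then have "cl u = cl (v @ reflection_word j)"
      using u by (simp add: reflection_def dihedral_simps)
    from bw_gword_eq[OF this]
    have "bw (gword u @ [E j]) = bw (gword (v @ reflection_word j)) \<otimes>\<^bsub>B\<^esub> bw [E j]"
      using assms by (simp flip: bw_mult)
    also have "\<dots> = bw (gword v) \<otimes>\<^bsub>B\<^esub> bw (sword j @ [E j])"
      using assms by (simp add: bw_mult)
    also have "\<dots> = bw (gword v @ [E j])"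
      using assms by (simp add: bw_s_e) (simp add: bw_mult)
    finally show ?thesis .
  qed
qed

text \<open>Writing the row index as \<open>act (cl u) j\<close> keeps a concrete word at hand;
  \<open>act_transitive\<close> shows that every row index has this form.\<close>

lemma kr_elems_eq:
  assumes "j < m"
  shows "kr_elems m \<tau> (act (cl u) j) j = {bw (gword u @ [E j])}"
proof -
  have "kr_elems m \<tau> (act (cl u) j) j
      = {bw (gword v) \<otimes>\<^bsub>B\<^esub> bw [E j] | v. act (cl v) j = act (cl u) j}"
    unfolding kr_elems_def brauer_e_def
    using act_eq_iff[of "cl _" "act (cl u) j" j] act_less[of "cl u" j]
    by (auto simp: dihedral_simps(1) simp flip: brauer_of_group_cl)
  also have "\<dots> = {bw (gword u @ [E j])}"
  proof -
    have "bw (gword v) \<otimes>\<^bsub>B\<^esub> bw [E j] = bw (gword u @ [E j])"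
      if "act (cl v) j = act (cl u) j" for v
      using bw_kr_eq[OF assms that] assms by (simp add: bw_mult)
    then show ?thesis by blast
  qed
  finally show ?thesis .
qed

lemma act_transitive:
  assumes "i < m" "j < m"
  obtains u where "act (cl u) j = i"
  using conj_index[OF assms] by (auto simp: reflection_def)

lemma kr_elem_eq: "j < m \<Longrightarrow> kr_elem m \<tau> (act (cl u) j) j = bw (gword u @ [E j])"
  by (simp add: kr_elem_def kr_elems_eq)

fun cell_elem :: "cell \<Rightarrow> (bgen list \<Rightarrow> complex) set" where
  "cell_elem (Grp w) = brauer_of_group m \<tau> w"
| "cell_elem (Kr i j) = kr_elem m \<tau> i j"

text \<open>The link between the abstract cells and the algebra. A word of scalar 1 for each cell
  makes the coordinates of the cell elements a Kronecker delta.\<close>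

lemma cell_elem_bw:
  assumes "b \<in> cells"
  obtains u where "u \<in> lists X" "cell_elem b = bw u" "nf u = b" "scal u = 1"
proof (cases b)
  case (Grp w)
  with assms obtain u where "w = cl u" by (auto simp: dihedral_simps)
  with Grp show ?thesis
    using that[of "gword u"] by (simp add: brauer_of_group_cl nf_gword scal_gword)
next
  case (Kr i j)
  with assms obtain u where "act (cl u) j = i" using act_transitive by auto
  with Kr assms show ?thesis
    using that[of "gword u @ [E j]"] kr_elem_eq[of j u]
    by (simp add: nf_append scal_append nf_gword scal_gword act_one)
qed

lemma cell_elem_closed [simp]: "b \<in> cells \<Longrightarrow> cell_elem b \<in> carrier B"
  by (metis cell_elem_bw bw_closed)

lemma coord_cell_elem: "b \<in> cells \<Longrightarrow> coord (cell_elem b) c = (if c = b then 1 else 0)"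
  by (erule cell_elem_bw) (auto simp: coord_bw coef_def)

section \<open>The multiplication table in the presented algebra\<close>

lemma bw_E_E:
  assumes "k < m" "i < m"
  shows "bw [E k, E i] = (if k = i then \<tau> \<odot>\<^bsub>B\<^esub> bw [E i] else bw (sword (conj_index m k i) @ [E i]))"
proof (cases "k = i")
  case True
  have "proj (monomial 1 [E i, E i]) = proj (monomial \<tau> [E i])"
    using assms by (intro proj_relation brauer_relations.e_square)
  also have "monomial \<tau> [E i] = \<tau> \<odot>\<^bsub>FX\<^esub> monomial 1 [E i]"
    by (auto simp: monomial_def monoid_algebra_simps)
  finally show ?thesis
    using True assms by (simp add: bw_eq proj_smult[folded brauer_algebra_def] monomial_closed)
next
  case False
  then show ?thesis using assms by (auto intro!: bw_relation brauer_relations.e_e_left)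
qed

text \<open>The converse of the consistency check: the relations suffice to derive the table. It is
  enough to treat a single generator on the left, since words are built up letter by letter.\<close>

lemma gen_mult_cell_elem:
  assumes "x \<in> X" "b \<in> cells"
  shows "bw [x] \<otimes>\<^bsub>B\<^esub> cell_elem b = twist (gen x) b \<odot>\<^bsub>B\<^esub> cell_elem (cmul (gen x) b)"
proof (cases x)
  case (Refl y)
  show ?thesis
  proof (cases b)
    case (Grp w)
    with assms obtain u where "w = cl u" by (auto simp: dihedral_simps)
    with Refl Grp show ?thesis
      by (simp add: brauer_of_group_cl dihedral_simps bw_mult B.scalar_simps)
  next
    case (Kr i j)
    with assms obtain u where u: "act (cl u) j = i" "i < m" "j < m" using act_transitive by auto
    have "cl (y # u) = cl [y] \<otimes>\<^bsub>D\<^esub> cl u" by (simp add: dihedral_simps)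
    then have "act (cl [y]) i = act (cl (y # u)) j" using u by (simp add: act_mult)
    with Refl Kr u kr_elem_eq[of j u] kr_elem_eq[of j "y # u"] show ?thesis
      by (simp add: bw_mult B.scalar_simps)
  qed
next
  case (E k)
  then have k: "k < m" using assms by simp
  show ?thesis
  proof (cases b)
    case (Grp w)
    with assms obtain u where u: "w = cl u" by (auto simp: dihedral_simps)
    \<comment> \<open>Here e(k) w = w e(j), so the product is the matrix unit with indices k,
      j.\<close>
    define j where "j = act (inv\<^bsub>D\<^esub> w) k"
    have j: "j < m" "act (cl u) j = k" using k by (simp_all add: j_def act_less u act_inv)
    moreover have "act (inv\<^bsub>D\<^esub> cl u) k = j" by (simp add: j_def u)
    ultimately show ?thesis
      using E Grp u k bw_transport[of j u] kr_elem_eq[of j u]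
      by (simp add: brauer_of_group_cl bw_mult B.scalar_simps)
  next
    case (Kr i j)
    with assms obtain u where u: "act (cl u) j = i" "i < m" "j < m" using act_transitive by auto
    \<comment> \<open>The matrix unit is rewritten from w e(j) to e(i) w, so that e(k) and e(i)
      become adjacent and \<open>bw_E_E\<close> applies. Afterwards w is moved back to the
      left.\<close>
    have "bw [E k] \<otimes>\<^bsub>B\<^esub> cell_elem b = bw [E k] \<otimes>\<^bsub>B\<^esub> bw ([E i] @ gword u)"
      using u Kr kr_elem_eq[of j u] bw_transport[of j u] by simp
    also have "\<dots> = bw [E k, E i] \<otimes>\<^bsub>B\<^esub> bw (gword u)"
      using u k by (simp add: bw_mult)
    also have "\<dots> = twist (gen x) b \<odot>\<^bsub>B\<^esub> cell_elem (cmul (gen x) b)"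
    proof (cases "k = i")
      case True
      then show ?thesis
        using u Kr E kr_elem_eq[of j u] bw_transport[of j u]
        by (simp add: bw_E_E B.smult_mult_left bw_mult)
    next
      case False
      let ?k = "conj_index m k i"
      have "bw [E k, E i] \<otimes>\<^bsub>B\<^esub> bw (gword u) = bw (sword ?k) \<otimes>\<^bsub>B\<^esub> bw ([E i] @ gword u)"
        using u k False by (simp add: bw_E_E bw_mult)
      also have "\<dots> = bw (sword ?k) \<otimes>\<^bsub>B\<^esub> bw (gword u @ [E j])"
        using u bw_transport[of j u] by simp
      also have "\<dots> = bw (gword (reflection_word ?k @ u) @ [E j])"
        using u by (simp add: bw_mult)
      also have "\<dots> = kr_elem m \<tau> k j"
      proof -
        have "act (cl (reflection_word ?k @ u)) j = k"
          using conj_index(2)[OF k u(2)] u by (simp add: reflection_def act_mult flip: dihedral_simps(3))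
        then show ?thesis using kr_elem_eq[of j "reflection_word ?k @ u"] u by simp
      qed
      finally show ?thesis
        using False Kr E u k cell_elem_closed[of "Kr k j"] by (simp add: B.scalar_simps)
    qed
    finally show ?thesis by (simp only: E)
  qed
qed

lemma bw_eq_cell_elem: "u \<in> lists X \<Longrightarrow> bw u = scal u \<odot>\<^bsub>B\<^esub> cell_elem (nf u)"
proof (induction u)
  case Nil
  show ?case using brauer_of_group_cl[of "[]"] by (simp add: B.scalar_simps dihedral_simps)
next
  case (Cons x u)
  then have xu: "x \<in> X" "u \<in> lists X" by auto
  have "bw (x # u) = bw [x] \<otimes>\<^bsub>B\<^esub> bw u" using xu by (simp add: bw_mult)
  also have "\<dots> = scal u \<odot>\<^bsub>B\<^esub> (bw [x] \<otimes>\<^bsub>B\<^esub> cell_elem (nf u))"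
    using xu Cons.IH by (simp add: B.smult_mult_right nf_closed)
  also have "\<dots> = (scal u * twist (gen x) (nf u)) \<odot>\<^bsub>B\<^esub> cell_elem (cmul (gen x) (nf u))"
    using xu by (simp add: gen_mult_cell_elem nf_closed B.scalar_simps gen_closed cmul_closed)
  finally show ?case by (simp add: mult.commute)
qed

section \<open>Expansion of elements in the cell basis\<close>

definition of_coords :: "(cell \<Rightarrow> complex) \<Rightarrow> (bgen list \<Rightarrow> complex) set" where
  "of_coords \<phi> = (\<Oplus>\<^bsub>B\<^esub>b\<in>cells. \<phi> b \<odot>\<^bsub>B\<^esub> cell_elem b)"

lemma of_coords_closed [simp]: "of_coords \<phi> \<in> carrier B"
  unfolding of_coords_def by (intro B.finsum_closed) (auto simp: B.scalar_simps)

lemma coord_of_coords: "coord (of_coords \<phi>) b = (if b \<in> cells then \<phi> b else 0)"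
proof -
  have "coord (of_coords \<phi>) b = (\<Sum>c\<in>cells. \<phi> c * (if b = c then 1 else 0))"
    unfolding of_coords_def
    by (subst coord_finsum) (auto simp: finite_cells B.scalar_simps coord_smult coord_cell_elem intro!: sum.cong)
  also have "\<dots> = (\<Sum>c\<in>cells. if b = c then \<phi> c else 0)"
    by (intro sum.cong) auto
  finally show ?thesis by (simp add: finite_cells)
qed

lemma of_coords_add:
  "of_coords (\<lambda>b. \<phi> b + \<psi> b) = of_coords \<phi> \<oplus>\<^bsub>B\<^esub> of_coords \<psi>"
proof -
  have "of_coords (\<lambda>b. \<phi> b + \<psi> b)
      = (\<Oplus>\<^bsub>B\<^esub>b\<in>cells. \<phi> b \<odot>\<^bsub>B\<^esub> cell_elem b \<oplus>\<^bsub>B\<^esub> \<psi> b \<odot>\<^bsub>B\<^esub> cell_elem b)"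
    unfolding of_coords_def by (intro B.finsum_cong') (simp_all add: B.scalar_simps)
  also have "\<dots> = of_coords \<phi> \<oplus>\<^bsub>B\<^esub> of_coords \<psi>"
    unfolding of_coords_def by (rule B.finsum_addf) (auto simp: B.scalar_simps)
  finally show ?thesis .
qed

lemma of_coords_single:
  assumes "b \<in> cells"
  shows "of_coords (\<lambda>c. if c = b then x else 0) = x \<odot>\<^bsub>B\<^esub> cell_elem b"
proof -
  have "of_coords (\<lambda>c. if c = b then x else 0)
      = (\<Oplus>\<^bsub>B\<^esub>c\<in>cells. if b = c then x \<odot>\<^bsub>B\<^esub> cell_elem c else \<zero>\<^bsub>B\<^esub>)"
    unfolding of_coords_def by (intro B.finsum_cong') (auto simp: B.scalar_simps)
  then show ?thesis
    using B.add.finprod_singleton[OF assms finite_cells, of "\<lambda>c. x \<odot>\<^bsub>B\<^esub> cell_elem c"]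
    by (simp add: B.scalar_simps finsum_def)
qed

text \<open>By linearity one monomial is enough. Its coordinate vector is concentrated at the cell
  of its word, and \<open>bw_eq_cell_elem\<close> identifies the monomial with that multiple of the
  cell element.\<close>

lemma of_coords_coord:
  assumes "P \<in> carrier B"
  shows "of_coords (coord P) = P"
proof -
  obtain p where p: "p \<in> carrier FX" "P = proj p" using assms by (auto simp: B_simps)
  from p(1) have "of_coords (coord (proj p)) = proj p"
  proof (induction rule: free_algebra_induct)
    case zero
    have "of_coords (\<lambda>_. 0) = \<zero>\<^bsub>B\<^esub>"
      unfolding of_coords_def by (intro B.add.finprod_one_eqI[folded finsum_def]) (simp add: B.scalar_simps)
    then show ?case by (simp add: coord_zero[abs_def] flip: B_simps)
  next
    case (add f c u)
    have mono: "monomial c u = c \<odot>\<^bsub>FX\<^esub> monomial 1 u"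
      by (auto simp: monomial_def monoid_algebra_simps)
    have u: "proj (monomial c u) = (c * scal u) \<odot>\<^bsub>B\<^esub> cell_elem (nf u)"
      using add.hyps bw_eq_cell_elem[of u] unfolding mono
      by (simp add: bw_eq proj_smult[folded brauer_algebra_def, symmetric] monomial_closed nf_closed
          B.scalar_simps)
    have cl: "proj f \<in> carrier B" "proj (monomial c u) \<in> carrier B"
      using add.hyps by (auto simp: B_simps monomial_closed)
    have cu: "coord (proj (monomial c u)) = (\<lambda>b. if b = nf u then c * scal u else 0)"
      using add.hyps by (intro ext) (simp add: coord_proj monomial_closed coef_def)
    have "proj (f \<oplus>\<^bsub>FX\<^esub> monomial c u) = proj f \<oplus>\<^bsub>B\<^esub> proj (monomial c u)"
      using add.hyps by (simp add: B_simps monomial_closed)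
    moreover have "coord (proj f \<oplus>\<^bsub>B\<^esub> proj (monomial c u))
        = (\<lambda>b. coord (proj f) b + coord (proj (monomial c u)) b)"
      using cl by (auto simp: coord_add)
    ultimately show ?case
      using add.IH of_coords_single[of "nf u" "c * scal u"] add.hyps
      by (simp add: of_coords_add cu[unfolded u] nf_closed u)
  qed
  then show ?thesis by (simp add: p)
qed

lemma coord_eqI:
  assumes "P \<in> carrier B" "Q \<in> carrier B" "\<And>b. b \<in> cells \<Longrightarrow> coord P b = coord Q b"
  shows "P = Q"
proof -
  have "of_coords (coord P) = of_coords (coord Q)"
    unfolding of_coords_def using assms by (intro B.finsum_cong') (auto simp: B.scalar_simps)
  then show ?thesis using assms by (simp add: of_coords_coord)
qed

end

section \<open>Linear spans\<close>

context complex_algebra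
begin

lemma lin_span_base:
  assumes "x \<in> X" "X \<subseteq> carrier A"
  shows "x \<in> lin_span A X"
proof -
  have "x = (\<Oplus>b\<in>{x}. 1 \<odot> b)" using assms by (auto simp: scalar_simps)
  then show ?thesis
    unfolding lin_span_def using assms(1) by (intro CollectI exI[of _ "{x}"] exI[of _ "\<lambda>_. 1"]) simp
qed

lemma lin_span_zero: "\<zero> \<in> lin_span A X"
  unfolding lin_span_def by (auto intro!: exI[of _ "{}"])

lemma lin_span_smult:
  assumes "x \<in> lin_span A X" "X \<subseteq> carrier A"
  shows "d \<odot> x \<in> lin_span A X"
proof -
  obtain F c where F: "finite F" "F \<subseteq> X" and x: "x = (\<Oplus>b\<in>F. c b \<odot> b)"
    using assms(1) by (auto simp: lin_span_def)
  have "d \<odot> x = (\<Oplus>b\<in>F. d \<odot> (c b \<odot> b))"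
    unfolding x using F assms(2) by (intro finsum_smult_ldistr) (auto simp: scalar_simps)
  also have "\<dots> = (\<Oplus>b\<in>F. (d * c b) \<odot> b)"
    using F assms(2) by (intro finsum_cong') (auto simp: scalar_simps)
  finally show ?thesis
    unfolding lin_span_def using F by (intro CollectI exI[of _ F] exI[of _ "\<lambda>b. d * c b"]) simp
qed

lemma lin_span_add:
  assumes "x \<in> lin_span A X" "y \<in> lin_span A X" "X \<subseteq> carrier A"
  shows "x \<oplus> y \<in> lin_span A X"
proof -
  obtain F c where F: "finite F" "F \<subseteq> X" and x: "x = (\<Oplus>b\<in>F. c b \<odot> b)"
    using assms(1) by (auto simp: lin_span_def)
  obtain H d where H: "finite H" "H \<subseteq> X" and y: "y = (\<Oplus>b\<in>H. d b \<odot> b)"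
    using assms(2) by (auto simp: lin_span_def)
  \<comment> \<open>Padding both coefficient families by 0 lets the two sums run over the common set
    F \<union> H.\<close>
  define c' where "c' b = (if b \<in> F then c b else 0)" for b
  define d' where "d' b = (if b \<in> H then d b else 0)" for b
  have "x = (\<Oplus>b\<in>F \<union> H. c' b \<odot> b)"
    unfolding x using F H assms(3)
    by (intro add.finprod_mono_neutral_cong_left) (auto simp: c'_def scalar_simps subset_iff)
  moreover have "y = (\<Oplus>b\<in>F \<union> H. d' b \<odot> b)"
    unfolding y using F H assms(3)
    by (intro add.finprod_mono_neutral_cong_left) (auto simp: d'_def scalar_simps subset_iff)
  ultimately have "x \<oplus> y = (\<Oplus>b\<in>F \<union> H. c' b \<odot> b \<oplus> d' b \<odot> b)"
    using F H assms(3) by (subst finsum_addf) (auto simp: scalar_simps)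
  also have "\<dots> = (\<Oplus>b\<in>F \<union> H. (c' b + d' b) \<odot> b)"
    using F H assms(3) by (intro finsum_cong') (auto simp: scalar_simps)
  finally show ?thesis
    unfolding lin_span_def using F H by (intro CollectI exI[of _ "F \<union> H"] exI[of _ "\<lambda>b. c' b + d' b"]) simp
qed

lemma lin_span_closed: "X \<subseteq> carrier A \<Longrightarrow> lin_span A X \<subseteq> carrier A"
  unfolding lin_span_def by (auto intro!: finsum_closed simp: scalar_simps)

lemma lin_span_finsum:
  assumes "finite S" "\<And>i. i \<in> S \<Longrightarrow> f i \<in> lin_span A X" "X \<subseteq> carrier A"
  shows "finsum A f S \<in> lin_span A X"
  using assms(1,2)
proof (induction S rule: finite_induct)
  case (insert i S)
  then have "f \<in> S \<rightarrow> carrier A" "f i \<in> carrier A"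
    using lin_span_closed[OF assms(3)] by auto
  then show ?case using insert assms(3) by (simp add: lin_span_add)
qed (simp add: lin_span_zero)

end

lemma lin_span_mono: "X \<subseteq> Y \<Longrightarrow> lin_span A X \<subseteq> lin_span A Y"
  unfolding lin_span_def by blast

section \<open>The group algebra inside the Brauer algebra\<close>

context brauer
begin

abbreviation "GA \<equiv> group_algebra m"
abbreviation "incl \<equiv> brauer_of_group_algebra m \<tau>"

sublocale GA: complex_algebra GA
  by (rule monoid_algebra_complex_algebra) (rule D.monoid_axioms)

text \<open>The projection onto the group algebra along the span of the \<open>Kr\<close> elements.
  Members of the group algebra vanish outside the carrier, hence the value 0 there.\<close>

definition group_part :: "(bgen list \<Rightarrow> complex) set \<Rightarrow> sgen list set \<Rightarrow> complex" where
  "group_part P w = (if w \<in> carrier D then coord P (Grp w) else 0)"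

lemma GA_iff: "f \<in> carrier GA \<longleftrightarrow> (\<forall>w. f w \<noteq> 0 \<longrightarrow> w \<in> carrier D)"
  using finite_subset[OF _ finite_dihedral, of "{x. f x \<noteq> 0}"] by (auto simp: monoid_algebra_simps)

lemma GA_zero_outside: "f \<in> carrier GA \<Longrightarrow> w \<notin> carrier D \<Longrightarrow> f w = 0"
  by (auto simp: GA_iff)

lemma group_part_closed: "group_part P \<in> carrier GA"
  by (simp add: GA_iff group_part_def)

lemma GA_minus:
  assumes "f \<in> carrier GA" "g \<in> carrier GA"
  shows "(f \<ominus>\<^bsub>GA\<^esub> g) w = f w - g w"
proof -
  have "g \<oplus>\<^bsub>GA\<^esub> (\<ominus>\<^bsub>GA\<^esub> g) = \<zero>\<^bsub>GA\<^esub>" using assms by (simp add: GA.r_neg)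
  then have "g w + (\<ominus>\<^bsub>GA\<^esub> g) w = 0" by (simp add: monoid_algebra_simps fun_eq_iff)
  then show ?thesis by (simp add: GA.minus_eq monoid_algebra_simps eq_neg_iff_add_eq_0 add.commute)
qed

lemma GA_finsum:
  "finite S \<Longrightarrow> f \<in> S \<rightarrow> carrier GA \<Longrightarrow> finsum GA f S w = (\<Sum>x\<in>S. f x w)"
  by (induction S rule: finite_induct) (simp_all add: monoid_algebra_simps(2,4) Pi_iff)

lemma GA_smult: "(c \<odot>\<^bsub>GA\<^esub> f) w = c * f w"
  by (simp add: monoid_algebra_simps)

lemma sum_cells:
  "(\<Sum>b\<in>cells. h b) = (\<Sum>w\<in>carrier D. h (Grp w)) + (\<Sum>(i, j)\<in>{..<m} \<times> {..<m}. h (Kr i j))"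
  unfolding cells_def using finite_dihedral
  by (subst sum.union_disjoint) (auto simp: sum.reindex inj_on_def case_prod_unfold)

text \<open>The span of the \<open>Kr\<close> elements is an ideal: only two group cells multiply to
  a group cell, and their twist is 1.\<close>

lemma group_part_mult:
  assumes "P \<in> carrier B" "Q \<in> carrier B"
  shows "group_part (P \<otimes>\<^bsub>B\<^esub> Q) = group_part P \<otimes>\<^bsub>GA\<^esub> group_part Q"
proof
  fix w
  have pairing: "pairing (group_part S) \<phi> = (\<Sum>v\<in>carrier D. coord S (Grp v) * \<phi> v)" for S \<phi>
    by (subst pairing_superset[OF finite_dihedral])
      (auto simp: group_part_def split: if_splits intro!: sum.cong)
  have fin: "finite {x. group_part S x \<noteq> 0}" for S
    using group_part_closed[of S] by (simp add: monoid_algebra_simps)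
  have rhs: "(group_part P \<otimes>\<^bsub>GA\<^esub> group_part Q) w = (\<Sum>y\<in>carrier D. \<Sum>z\<in>carrier D.
      (if y \<otimes>\<^bsub>D\<^esub> z = w then 1 else 0) * (coord P (Grp y) * coord Q (Grp z)))"
    by (simp add: monoid_algebra_mult[OF fin fin] pairing sum_distrib_left mult_ac)
  show "group_part (P \<otimes>\<^bsub>B\<^esub> Q) w = (group_part P \<otimes>\<^bsub>GA\<^esub> group_part Q) w"
  proof (cases "w \<in> carrier D")
    case True
    then show ?thesis
      unfolding rhs by (simp add: group_part_def coord_mult[OF assms] sum_cells) (intro sum.cong refl, simp)
  next
    case False
    then have "(group_part P \<otimes>\<^bsub>GA\<^esub> group_part Q) w = 0"
      by (intro GA_zero_outside GA.m_closed group_part_closed)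
    with False show ?thesis by (simp add: group_part_def)
  qed
qed

lemma incl_closed: "f \<in> carrier GA \<Longrightarrow> incl f \<in> carrier B"
  unfolding brauer_of_group_algebra_def
  using cell_elem_closed[of "Grp _"] by (intro B.finsum_closed) (auto simp: GA_iff B.scalar_simps)

lemma coord_incl:
  assumes f: "f \<in> carrier GA" and b: "b \<in> cells"
  shows "coord (incl f) b = (case b of Grp w \<Rightarrow> f w | Kr i j \<Rightarrow> 0)"
proof -
  have fin: "finite {w. f w \<noteq> 0}" using f by (simp add: monoid_algebra_simps)
  have cl: "cell_elem (Grp w) \<in> carrier B" if "f w \<noteq> 0" for w
    using that f by (intro cell_elem_closed) (auto simp: GA_iff)
  have "coord (incl f) b = (\<Sum>w | f w \<noteq> 0. f w * coord (cell_elem (Grp w)) b)"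
    unfolding brauer_of_group_algebra_def using cl
    by (subst coord_finsum[OF fin]) (auto simp: B.scalar_simps coord_smult intro!: sum.cong)
  also have "\<dots> = (\<Sum>w | f w \<noteq> 0. if b = Grp w then f w else 0)"
    using f by (intro sum.cong) (auto simp: coord_cell_elem GA_iff simp del: cell_elem.simps)
  also have "\<dots> = (case b of Grp w \<Rightarrow> f w | Kr i j \<Rightarrow> 0)"
    using fin by (cases b) auto
  finally show ?thesis .
qed

lemma group_part_incl: "f \<in> carrier GA \<Longrightarrow> group_part (incl f) = f"
  by (auto simp: group_part_def coord_incl GA_zero_outside)

lemma inj_on_incl: "inj_on incl (carrier GA)"
  by (metis group_part_incl inj_on_inverseI)

text \<open>Since \<open>incl\<close> sums over the support of its argument, its linearity is not
  visible term by term; it is read off from the coordinates.\<close>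

lemma incl_lin_span:
  assumes "f \<in> lin_span GA Y" "Y \<subseteq> carrier GA"
  shows "incl f \<in> lin_span B (incl ` Y)"
proof -
  obtain F c where F: "finite F" "F \<subseteq> Y" and f: "f = (\<Oplus>\<^bsub>GA\<^esub>b\<in>F. c b \<odot>\<^bsub>GA\<^esub> b)"
    using assms(1) by (auto simp: lin_span_def)
  have cl: "(\<lambda>b. c b \<odot>\<^bsub>GA\<^esub> b) \<in> F \<rightarrow> carrier GA" "(\<lambda>b. c b \<odot>\<^bsub>B\<^esub> incl b) \<in> F \<rightarrow> carrier B"
    using F assms(2) by (auto simp: GA.scalar_simps B.scalar_simps incl_closed)
  then have fc: "f \<in> carrier GA" unfolding f by (intro GA.finsum_closed)
  have "incl f = (\<Oplus>\<^bsub>B\<^esub>b\<in>F. c b \<odot>\<^bsub>B\<^esub> incl b)"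
  proof (rule coord_eqI)
    fix b assume b: "b \<in> cells"
    have "coord (\<Oplus>\<^bsub>B\<^esub>b\<in>F. c b \<odot>\<^bsub>B\<^esub> incl b) b = (\<Sum>g\<in>F. c g * coord (incl g) b)"
      using F assms(2) cl by (subst coord_finsum) (auto simp: coord_smult incl_closed intro!: sum.cong)
    also have "\<dots> = (\<Sum>g\<in>F. c g * (case b of Grp w \<Rightarrow> g w | Kr i j \<Rightarrow> 0))"
      using F assms(2) b by (intro sum.cong) (auto simp: coord_incl)
    also have "\<dots> = coord (incl f) b"
      using F cl fc b by (cases b) (simp_all add: coord_incl, simp add: f GA_finsum GA_smult)
    finally show "coord (incl f) b = coord (\<Oplus>\<^bsub>B\<^esub>b\<in>F. c b \<odot>\<^bsub>B\<^esub> incl b) b" ..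
  qed (use fc cl in \<open>auto intro: incl_closed B.finsum_closed\<close>)
  also have "\<dots> \<in> lin_span B (incl ` Y)"
    using F assms(2) incl_closed
    by (intro B.lin_span_finsum B.lin_span_smult B.lin_span_base) auto
  finally show ?thesis .
qed

text \<open>Splitting P into its group part and its \<open>Kr\<close> part reduces membership in a
  span that contains all \<open>Kr\<close> elements to a question in the group algebra. Both the
  spanning property and the multiplication rule for group cells use it.\<close>

lemma lin_span_decompose:
  assumes P: "P \<in> carrier B" and Y: "Y \<subseteq> carrier B" and group: "incl (group_part P) \<in> lin_span B Y"
    and kr: "\<And>i j. i < m \<Longrightarrow> j < m \<Longrightarrow> kr_elem m \<tau> i j \<in> Y"
  shows "P \<in> lin_span B Y"
proof -
  define \<phi> where "\<phi> b = (case b of Grp w \<Rightarrow> 0 | Kr i j \<Rightarrow> coord P b)" for b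
  have "P = incl (group_part P) \<oplus>\<^bsub>B\<^esub> of_coords \<phi>"
  proof (rule coord_eqI)
    fix b assume "b \<in> cells"
    then show "coord P b = coord (incl (group_part P) \<oplus>\<^bsub>B\<^esub> of_coords \<phi>) b"
      by (cases b) (simp_all add: coord_add incl_closed group_part_closed coord_incl coord_of_coords
          \<phi>_def group_part_def)
  qed (simp_all add: P incl_closed group_part_closed)
  moreover have "of_coords \<phi> \<in> lin_span B Y"
    unfolding of_coords_def
  proof (rule B.lin_span_finsum[OF finite_cells _ Y])
    fix b assume b: "b \<in> cells"
    then show "\<phi> b \<odot>\<^bsub>B\<^esub> cell_elem b \<in> lin_span B Y"
    proof (cases b)
      case (Grp w)
      then show ?thesis using b cell_elem_closed[OF b]
        by (simp add: \<phi>_def B.scalar_simps B.lin_span_zero)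
    next
      case (Kr i j)
      then show ?thesis using b kr Y by (intro B.lin_span_smult B.lin_span_base) auto
    qed
  qed
  ultimately show ?thesis using group Y B.lin_span_add by metis
qed

section \<open>The anti-involution\<close>

text \<open>Permuting coordinates by the involution \<open>cstar\<close> gives linearity at once;
  only the reversal of products has to be verified.\<close>

definition star :: "(bgen list \<Rightarrow> complex) set \<Rightarrow> (bgen list \<Rightarrow> complex) set" where
  "star = (\<lambda>P\<in>carrier B. of_coords (\<lambda>b. coord P (cstar b)))"

lemma star_closed [simp]: "P \<in> carrier B \<Longrightarrow> star P \<in> carrier B"
  by (simp add: star_def)

lemma coord_star: "P \<in> carrier B \<Longrightarrow> b \<in> cells \<Longrightarrow> coord (star P) b = coord P (cstar b)"
  by (simp add: star_def coord_of_coords)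

lemma star_add:
  "P \<in> carrier B \<Longrightarrow> Q \<in> carrier B \<Longrightarrow> star (P \<oplus>\<^bsub>B\<^esub> Q) = star P \<oplus>\<^bsub>B\<^esub> star Q"
  by (rule coord_eqI) (simp_all add: coord_star coord_add)

lemma star_smult: "P \<in> carrier B \<Longrightarrow> star (c \<odot>\<^bsub>B\<^esub> P) = c \<odot>\<^bsub>B\<^esub> star P"
  by (rule coord_eqI) (simp_all add: coord_star coord_smult B.scalar_simps)

lemma star_star: "P \<in> carrier B \<Longrightarrow> star (star P) = P"
  by (rule coord_eqI) (simp_all add: coord_star cstar_closed cstar_cstar)

text \<open>\<open>cstar\<close> reverses products of cells, and \<open>twist\<close> is preserved
  because its condition j = k is symmetric. Substituting \<open>cstar\<close> in both summations
  therefore turns one side into the other.\<close>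

lemma star_mult:
  assumes P: "P \<in> carrier B" and Q: "Q \<in> carrier B"
  shows "star (P \<otimes>\<^bsub>B\<^esub> Q) = star Q \<otimes>\<^bsub>B\<^esub> star P"
proof (rule coord_eqI)
  fix b assume b: "b \<in> cells"
  have flip: "(\<Sum>a\<in>cells. h a) = (\<Sum>a\<in>cells. h (cstar a))" for h :: "cell \<Rightarrow> complex"
    by (rule sum.reindex_bij_witness[of _ cstar cstar]) (auto simp: cstar_cstar cstar_closed)
  have "coord (star Q \<otimes>\<^bsub>B\<^esub> star P) b = (\<Sum>a\<in>cells. \<Sum>c\<in>cells.
      (if cmul a c = b then twist a c else 0) * (coord Q (cstar a) * coord P (cstar c)))"
    using P Q by (simp add: coord_mult coord_star)
  also have "\<dots> = (\<Sum>a\<in>cells. \<Sum>c\<in>cells.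
      (if cmul (cstar a) (cstar c) = b then twist (cstar a) (cstar c) else 0) *
      (coord Q (cstar (cstar a)) * coord P (cstar (cstar c))))"
    by (subst flip, rule sum.cong[OF refl], rule flip)
  also have "\<dots> = (\<Sum>a\<in>cells. \<Sum>c\<in>cells.
      (if cmul c a = cstar b then twist c a else 0) * (coord P c * coord Q a))"
  proof (intro sum.cong refl)
    fix a c assume ac: "a \<in> cells" "c \<in> cells"
    then have "cmul (cstar a) (cstar c) = b \<longleftrightarrow> cmul c a = cstar b"
      using b by (metis cmul_closed cmul_cstar cstar_cstar)
    then show "(if cmul (cstar a) (cstar c) = b then twist (cstar a) (cstar c) else 0) *
        (coord Q (cstar (cstar a)) * coord P (cstar (cstar c)))
      = (if cmul c a = cstar b then twist c a else 0) * (coord P c * coord Q a)"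
      using ac by (simp add: twist_cstar cstar_cstar)
  qed
  also have "\<dots> = coord (star (P \<otimes>\<^bsub>B\<^esub> Q)) b"
    using P Q b by (subst sum.swap) (simp add: coord_star coord_mult)
  finally show "coord (star (P \<otimes>\<^bsub>B\<^esub> Q)) b = coord (star Q \<otimes>\<^bsub>B\<^esub> star P) b" ..
qed (use P Q in simp_all)

lemma star_cell_elem: "b \<in> cells \<Longrightarrow> star (cell_elem b) = cell_elem (cstar b)"
  using cstar_cstar by (intro coord_eqI) (auto simp: coord_star coord_cell_elem cstar_closed)

lemma brauer_e_eq: "i < m \<Longrightarrow> brauer_e m \<tau> i = cell_elem (Kr i i)"
  using kr_elem_eq[of i "[]"] act_one[of i] by (simp add: brauer_e_def dihedral_simps)

lemma star_anti_involution: "linear_anti_involution B star"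
  unfolding linear_anti_involution_def by (auto simp: star_add star_smult star_mult star_star)

lemma is_brauer_star_star: "is_brauer_star m \<tau> star"
  unfolding is_brauer_star_def
proof (intro conjI ballI allI impI star_anti_involution)
  show "star \<in> extensional (carrier B)" by (simp add: star_def)
  show "star (brauer_of_group m \<tau> w) = brauer_of_group m \<tau> (inv\<^bsub>D\<^esub> w)" if "w \<in> carrier D" for w
    using star_cell_elem[of "Grp w"] that by simp
  show "star (brauer_e m \<tau> i) = brauer_e m \<tau> i" if "i < m" for i
    using star_cell_elem[of "Kr i i"] that by (simp add: brauer_e_eq)
qed

text \<open>The prescribed values on group elements and on the e(i) determine \<sigma> on every w
  e(j), hence on the cell basis.\<close>

lemma is_brauer_star_unique:
  assumes \<sigma>: "is_brauer_star m \<tau> \<sigma>"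
  shows "\<sigma> = star"
proof (rule extensionalityI)
  show "\<sigma> \<in> extensional (carrier B)" "star \<in> extensional (carrier B)"
    using \<sigma> by (simp_all add: is_brauer_star_def star_def)
  have closed: "P \<in> carrier B \<Longrightarrow> \<sigma> P \<in> carrier B"
    and add: "P \<in> carrier B \<Longrightarrow> Q \<in> carrier B \<Longrightarrow> \<sigma> (P \<oplus>\<^bsub>B\<^esub> Q) = \<sigma> P \<oplus>\<^bsub>B\<^esub> \<sigma> Q"
    and smult: "P \<in> carrier B \<Longrightarrow> \<sigma> (c \<odot>\<^bsub>B\<^esub> P) = c \<odot>\<^bsub>B\<^esub> \<sigma> P"
    and mult: "P \<in> carrier B \<Longrightarrow> Q \<in> carrier B \<Longrightarrow> \<sigma> (P \<otimes>\<^bsub>B\<^esub> Q) = \<sigma> Q \<otimes>\<^bsub>B\<^esub> \<sigma> P"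
    and grp: "w \<in> carrier D \<Longrightarrow> \<sigma> (brauer_of_group m \<tau> w) = brauer_of_group m \<tau> (inv\<^bsub>D\<^esub> w)"
    and e: "i < m \<Longrightarrow> \<sigma> (brauer_e m \<tau> i) = brauer_e m \<tau> i" for P Q c w i
    using \<sigma> by (auto simp: is_brauer_star_def linear_anti_involution_def)
  have cell: "\<sigma> (cell_elem b) = star (cell_elem b)" if b: "b \<in> cells" for b
  proof (cases b)
    case (Grp w)
    then show ?thesis using b star_cell_elem[OF b] by (simp add: grp)
  next
    case (Kr i j)
    with b obtain u where u: "act (cl u) j = i" "i < m" "j < m" using act_transitive by auto
    have "cell_elem b = cell_elem (Grp (cl u)) \<otimes>\<^bsub>B\<^esub> brauer_e m \<tau> j"
      using u Kr kr_elem_eq[of j u] by (simp add: brauer_of_group_cl brauer_e_def bw_mult)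
    moreover have "brauer_e m \<tau> j \<in> carrier B"
      using u cell_elem_closed[of "Kr j j"] by (simp add: brauer_e_eq)
    ultimately have "\<sigma> (cell_elem b) = brauer_e m \<tau> j \<otimes>\<^bsub>B\<^esub> cell_elem (Grp (inv\<^bsub>D\<^esub> cl u))"
      using u cell_elem_closed[of "Grp (cl u)"] by (simp add: mult grp e)
    also have "\<dots> = cell_elem (Kr j i)"
      \<comment> \<open>The image of w e(j) is e(j) times the inverse of w; right multiplication by
        that inverse moves the column index j to w j = i.\<close>
      using gen_mult_cell_elem[of "E j" "Grp (inv\<^bsub>D\<^esub> cl u)"] u cell_elem_closed[of "Kr j i"]
      by (simp add: brauer_e_def B.scalar_simps)
    finally show ?thesis using star_cell_elem[OF b] Kr by simp
  qed
  have zero: "\<sigma> \<zero>\<^bsub>B\<^esub> = \<zero>\<^bsub>B\<^esub>" "star \<zero>\<^bsub>B\<^esub> = \<zero>\<^bsub>B\<^esub>"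
    using smult[of "\<zero>\<^bsub>B\<^esub>" 0] star_smult[of "\<zero>\<^bsub>B\<^esub>" 0] closed[of "\<zero>\<^bsub>B\<^esub>"] by (simp_all add: B.scalar_simps)
  have "\<sigma> (\<Oplus>\<^bsub>B\<^esub>b\<in>S. \<phi> b \<odot>\<^bsub>B\<^esub> cell_elem b) = star (\<Oplus>\<^bsub>B\<^esub>b\<in>S. \<phi> b \<odot>\<^bsub>B\<^esub> cell_elem b)"
    if "finite S" "S \<subseteq> cells" for S \<phi>
    using that
  proof (induction S rule: finite_induct)
    case (insert b S)
    then have "(\<lambda>b. \<phi> b \<odot>\<^bsub>B\<^esub> cell_elem b) \<in> S \<rightarrow> carrier B" "\<phi> b \<odot>\<^bsub>B\<^esub> cell_elem b \<in> carrier B"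
      by (auto simp: B.scalar_simps)
    with insert show ?case
      by (simp add: add star_add B.finsum_closed) (simp add: smult star_smult cell)
  qed (simp add: zero)
  then have "\<sigma> (of_coords \<phi>) = star (of_coords \<phi>)" for \<phi>
    unfolding of_coords_def using finite_cells by blast
  then show "\<sigma> P = star P" if "P \<in> carrier B" for P
    using of_coords_coord[OF that] by metis
qed

lemma ex1_brauer_star: "\<exists>!s. is_brauer_star m \<tau> s"
  using is_brauer_star_star is_brauer_star_unique by blast

lemma brauer_star_eq: "brauer_star m \<tau> = star"
  unfolding brauer_star_def using is_brauer_star_star is_brauer_star_unique by (rule the_equality)

lemma star_incl:
  assumes "f \<in> carrier GA" "g \<in> carrier GA" "inversion m f = g"
  shows "star (incl f) = incl g"
proof (rule coord_eqI)
  fix b assume b: "b \<in> cells"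
  then show "coord (star (incl f)) b = coord (incl g) b"
    using assms by (cases b) (auto simp: coord_star incl_closed coord_incl inversion_def)
qed (use assms in \<open>simp_all add: incl_closed\<close>)

lemma kr_elems_singleton: "i < m \<Longrightarrow> j < m \<Longrightarrow> is_singleton (kr_elems m \<tau> i j)"
  using act_transitive kr_elems_eq by (metis is_singletonI)

end

section \<open>The cellular structure\<close>

locale brauer_cellular = brauer m \<tau> + cell: cellular_structure "group_algebra m" \<Lambda> po M C "inversion m"
  for m :: nat and \<tau> :: complex and \<Lambda> :: "'l set" and po :: "('l \<times> 'l) set" and M :: "'l \<Rightarrow> 's set"
    and C :: "'l \<Rightarrow> 's \<Rightarrow> 's \<Rightarrow> sgen list set \<Rightarrow> complex"
begin

abbreviation "\<Lambda>' \<equiv> bar_Lambda \<Lambda>"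
abbreviation "po' \<equiv> bar_po \<Lambda> po"
abbreviation "M' \<equiv> bar_M m M"
abbreviation "C' \<equiv> bar_C m \<tau> C"

section \<open>The two families of basis elements\<close>

definition group_cells :: "(sgen list set \<Rightarrow> complex) set" where
  "group_cells = (\<lambda>(l, S, T). C l S T) ` (SIGMA l:\<Lambda>. M l \<times> M l)"

definition kr_cells :: "(bgen list \<Rightarrow> complex) set set" where
  "kr_cells = {kr_elem m \<tau> i j | i j. i < m \<and> j < m}"

lemma group_cells_closed: "group_cells \<subseteq> carrier GA"
  using cell.C_basis by (simp add: lin_basis_def group_cells_def)

lemma C_closed: "l \<in> \<Lambda> \<Longrightarrow> S \<in> M l \<Longrightarrow> T \<in> M l \<Longrightarrow> C l S T \<in> carrier GA"
  using group_cells_closed by (force simp: group_cells_def)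

lemma kr_elem_closed [simp]: "i < m \<Longrightarrow> j < m \<Longrightarrow> kr_elem m \<tau> i j \<in> carrier B"
  using cell_elem_closed[of "Kr i j"] by simp

lemma coord_kr_elem:
  "i < m \<Longrightarrow> j < m \<Longrightarrow> coord (kr_elem m \<tau> i j) b = (if b = Kr i j then 1 else 0)"
  using coord_cell_elem[of "Kr i j"] by simp

lemma kr_elem_inject:
  assumes "i < m" "j < m" "k < m" "l < m"
  shows "kr_elem m \<tau> i j = kr_elem m \<tau> k l \<longleftrightarrow> i = k \<and> j = l"
  using coord_kr_elem[of i j "Kr i j"] coord_kr_elem[of k l "Kr i j"] assms by (auto split: if_splits)

lemma bar_cells_eq:
  "(\<lambda>(l, S, T). C' l S T) ` (SIGMA l:\<Lambda>'. M' l \<times> M' l) = incl ` group_cells \<union> kr_cells"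
  (is "?L = ?R")
proof
  show "?L \<subseteq> ?R"
  proof
    fix x assume "x \<in> ?L"
    then obtain l S T where l: "l \<in> \<Lambda>'" "S \<in> M' l" "T \<in> M' l" "x = C' l S T" by auto
    show "x \<in> ?R"
    proof (cases l)
      case None
      with l show ?thesis by (auto simp: kr_cells_def)
    next
      case (Some k)
      with l obtain S' T' where k: "k \<in> \<Lambda>" "S' \<in> M k" "T' \<in> M k" "x = incl (C k S' T')"
        by (auto simp: bar_Lambda_def)
      then have "C k S' T' \<in> group_cells"
        unfolding group_cells_def by (intro image_eqI[of _ _ "(k, S', T')"]) auto
      with k show ?thesis by blast
    qed
  qed
  show "?R \<subseteq> ?L"
  proof
    fix x assume "x \<in> ?R"
    then consider l S T where "l \<in> \<Lambda>" "S \<in> M l" "T \<in> M l" "x = incl (C l S T)"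
      | i j where "i < m" "j < m" "x = kr_elem m \<tau> i j"
      by (auto simp: group_cells_def kr_cells_def)
    then show "x \<in> ?L"
    proof cases
      case 1 then show ?thesis
        by (intro image_eqI[of _ _ "(Some l, Inl S, Inl T)"]) (auto simp: bar_Lambda_def)
    next
      case 2 then show ?thesis
        by (intro image_eqI[of _ _ "(None, Inr i, Inr j)"]) (auto simp: bar_Lambda_def)
    qed
  qed
qed

lemma bar_cells_closed: "incl ` group_cells \<union> kr_cells \<subseteq> carrier B"
  using group_cells_closed incl_closed by (auto simp: kr_cells_def)

lemma bar_order: "partial_order_on \<Lambda>' po'"
proof -
  have po: "refl_on \<Lambda> po" "trans po" "antisym po" "po \<subseteq> \<Lambda> \<times> \<Lambda>"
    using partial_order_onD[OF cell.order] by auto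
  have "refl_on \<Lambda>' po'"
    using po(1) by (auto simp: refl_on_def bar_po_def bar_Lambda_def)
  moreover have "trans po'"
    using po(2,4) by (auto simp: bar_po_def bar_Lambda_def intro!: transI dest: transD)
  moreover have "antisym po'"
    using po(3) by (auto simp: bar_po_def intro!: antisymI dest: antisymD)
  moreover have "po' \<subseteq> \<Lambda>' \<times> \<Lambda>'"
    using po(4) by (auto simp: bar_po_def bar_Lambda_def)
  ultimately show ?thesis by (simp add: partial_order_on_def preorder_on_def)
qed

section \<open>Injectivity, linear independence and spanning\<close>

lemma incl_neq_kr:
  assumes "f \<in> carrier GA" "i < m" "j < m"
  shows "incl f \<noteq> kr_elem m \<tau> i j"
  using coord_incl[OF assms(1), of "Kr i j"] coord_kr_elem[of i j "Kr i j"] assms by auto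

lemma bar_inj: "inj_on (\<lambda>(l, S, T). C' l S T) (SIGMA l:\<Lambda>'. M' l \<times> M' l)"
proof (rule inj_onI)
  fix p q assume pq: "p \<in> (SIGMA l:\<Lambda>'. M' l \<times> M' l)" "q \<in> (SIGMA l:\<Lambda>'. M' l \<times> M' l)"
    and eq: "(\<lambda>(l, S, T). C' l S T) p = (\<lambda>(l, S, T). C' l S T) q"
  have form: "(\<exists>l S T. l \<in> \<Lambda> \<and> S \<in> M l \<and> T \<in> M l \<and> p = (Some l, Inl S, Inl T)) \<or>
      (\<exists>i j. i < m \<and> j < m \<and> p = (None, Inr i, Inr j))"
    if "p \<in> (SIGMA l:\<Lambda>'. M' l \<times> M' l)" for p
    using that by (auto simp: bar_Lambda_def) blast
  have grp: "l = k \<and> S = S' \<and> T = T'"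
    if "l \<in> \<Lambda>" "S \<in> M l" "T \<in> M l" "k \<in> \<Lambda>" "S' \<in> M k" "T' \<in> M k" "incl (C l S T) = incl (C k S' T')"
    for l S T k S' T'
  proof -
    have "C l S T = C k S' T'" using that by (auto intro: inj_onD[OF inj_on_incl] C_closed)
    then show ?thesis using inj_onD[OF cell.C_inj, of "(l, S, T)" "(k, S', T')"] that by auto
  qed
  from form[OF pq(1)] form[OF pq(2)] show "p = q"
  proof (elim disjE exE conjE)
    fix l S T k S' T'
    assume "l \<in> \<Lambda>" "S \<in> M l" "T \<in> M l" "p = (Some l, Inl S, Inl T)"
      "k \<in> \<Lambda>" "S' \<in> M k" "T' \<in> M k" "q = (Some k, Inl S', Inl T')"
    with eq grp[of l S T k S' T'] show "p = q" by simp
  next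
    fix l S T i j
    assume "l \<in> \<Lambda>" "S \<in> M l" "T \<in> M l" "p = (Some l, Inl S, Inl T)"
      "i < m" "j < m" "q = (None, Inr i, Inr j)"
    with eq incl_neq_kr[OF C_closed[of l S T]] show "p = q" by simp
  next
    fix l S T i j
    assume "l \<in> \<Lambda>" "S \<in> M l" "T \<in> M l" "q = (Some l, Inl S, Inl T)"
      "i < m" "j < m" "p = (None, Inr i, Inr j)"
    with eq incl_neq_kr[OF C_closed[of l S T], symmetric] show "p = q" by simp
  next
    fix i j k l
    assume "i < m" "j < m" "p = (None, Inr i, Inr j)" "k < m" "l < m" "q = (None, Inr k, Inr l)"
    with eq kr_elem_inject[of i j k l] show "p = q" by simp
  qed
qed

text \<open>Coordinates separate the two families. At group cells the \<open>Kr\<close> elements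
  vanish, so a relation restricts to one in the group algebra, where the given basis is independent.
  At \<open>Kr i j\<close> every other member of F vanishes, which isolates a single
  coefficient.\<close>

lemma bar_independent: "lin_independent B (incl ` group_cells \<union> kr_cells)"
  unfolding lin_independent_def
proof (intro allI impI ballI)
  fix F c x
  assume F: "finite F \<and> F \<subseteq> incl ` group_cells \<union> kr_cells \<and> (\<Oplus>\<^bsub>B\<^esub>b\<in>F. c b \<odot>\<^bsub>B\<^esub> b) = \<zero>\<^bsub>B\<^esub>"
    and x: "x \<in> F"
  then have cl: "F \<subseteq> carrier B" using bar_cells_closed by blast
  have sum0: "(\<Sum>y\<in>F. c y * coord y b) = 0" for b
  proof -
    have "(\<Sum>y\<in>F. c y * coord y b) = coord (\<Oplus>\<^bsub>B\<^esub>b\<in>F. c b \<odot>\<^bsub>B\<^esub> b) b"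
      using F cl by (subst coord_finsum) (auto simp: B.scalar_simps coord_smult intro!: sum.cong)
    then show ?thesis using F by (simp add: coord_zero)
  qed
  from x F consider f where "f \<in> group_cells" "x = incl f" | i j where "i < m" "j < m" "x = kr_elem m \<tau> i j"
    by (auto simp: kr_cells_def)
  then show "c x = 0"
  proof cases
    case 1
    \<comment> \<open>The part of F coming from the group algebra, pulled back along the injective
      map \<open>incl\<close>.\<close>
    define H where "H = {g \<in> group_cells. incl g \<in> F}"
    have inj: "inj_on incl H"
      using group_cells_closed by (auto simp: H_def intro: inj_on_subset[OF inj_on_incl])
    have H: "finite H" "H \<subseteq> group_cells" "H \<subseteq> carrier GA"
      using F group_cells_closed finite_imageD[OF _ inj] finite_subset[of "incl ` H" F]
      by (auto simp: H_def)
    have "(\<Oplus>\<^bsub>GA\<^esub>g\<in>H. c (incl g) \<odot>\<^bsub>GA\<^esub> g) w = 0" for w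
    proof -
      have eq: "(\<Oplus>\<^bsub>GA\<^esub>g\<in>H. c (incl g) \<odot>\<^bsub>GA\<^esub> g) w = (\<Sum>g\<in>H. c (incl g) * g w)"
        using H by (subst GA_finsum) (auto simp: GA.scalar_simps GA_smult)
      show ?thesis
      proof (cases "w \<in> carrier D")
        case True
        have "(\<Sum>g\<in>H. c (incl g) * g w) = (\<Sum>g\<in>H. c (incl g) * coord (incl g) (Grp w))"
          using H True by (intro sum.cong) (auto simp: coord_incl)
        also have "\<dots> = (\<Sum>y\<in>incl ` H. c y * coord y (Grp w))"
          by (simp add: sum.reindex[OF inj])
        also have "\<dots> = (\<Sum>y\<in>F. c y * coord y (Grp w))"
        proof (rule sum.mono_neutral_left)
          show "\<forall>y\<in>F - incl ` H. c y * coord y (Grp w) = 0"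
          proof
            fix y assume "y \<in> F - incl ` H"
            then have "y \<in> kr_cells" using F by (auto simp: H_def)
            then show "c y * coord y (Grp w) = 0" by (auto simp: kr_cells_def coord_kr_elem)
          qed
        qed (use F in \<open>auto simp: H_def\<close>)
        finally show ?thesis using eq sum0 by simp
      next
        case False
        then have "g w = 0" if "g \<in> H" for g using that H GA_zero_outside by blast
        then show ?thesis unfolding eq by (intro sum.neutral) simp
      qed
    qed
    then have "(\<Oplus>\<^bsub>GA\<^esub>g\<in>H. c (incl g) \<odot>\<^bsub>GA\<^esub> g) = \<zero>\<^bsub>GA\<^esub>"
      by (auto simp: monoid_algebra_simps)
    moreover have "lin_independent GA group_cells"
      using cell.C_basis by (simp add: lin_basis_def group_cells_def)
    ultimately have "c (incl g) = 0" if "g \<in> H" for g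
      unfolding lin_independent_def using H that
      by (elim allE[of _ H] allE[of _ "\<lambda>g. c (incl g)"]) simp
    then show ?thesis using 1 x by (simp add: H_def)
  next
    case 2
    have "c y * coord y (Kr i j) = (if y = x then c y else 0)" if "y \<in> F" for y
    proof -
      from that F consider f where "f \<in> group_cells" "y = incl f"
        | k l where "k < m" "l < m" "y = kr_elem m \<tau> k l"
        by (auto simp: kr_cells_def)
      then show ?thesis
      proof cases
        case 1
        then have "y \<noteq> x" using 2 incl_neq_kr group_cells_closed by auto
        then show ?thesis using 1 2 coord_incl[of f "Kr i j"] group_cells_closed by auto
      qed (use 2 in \<open>auto simp: coord_kr_elem kr_elem_inject\<close>)
    qed
    then have "(\<Sum>y\<in>F. if y = x then c y else 0) = 0"
      using sum0[of "Kr i j"] by simp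
    then show ?thesis using F x by simp
  qed
qed

lemma bar_basis: "lin_basis B (incl ` group_cells \<union> kr_cells)"
  unfolding lin_basis_def
proof (intro conjI bar_cells_closed bar_independent equalityI)
  show "lin_span B (incl ` group_cells \<union> kr_cells) \<subseteq> carrier B"
    by (rule B.lin_span_closed[OF bar_cells_closed])
  show "carrier B \<subseteq> lin_span B (incl ` group_cells \<union> kr_cells)"
  proof
    fix P assume P: "P \<in> carrier B"
    have "group_part P \<in> lin_span GA group_cells"
      using cell.C_basis group_part_closed by (simp add: lin_basis_def group_cells_def)
    then have "incl (group_part P) \<in> lin_span B (incl ` group_cells)"
      by (rule incl_lin_span[OF _ group_cells_closed])
    then show "P \<in> lin_span B (incl ` group_cells \<union> kr_cells)"
      using lin_span_mono[of "incl ` group_cells" "incl ` group_cells \<union> kr_cells" B]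
      by (intro lin_span_decompose[OF P bar_cells_closed]) (auto simp: kr_cells_def)
  qed
qed

section \<open>The anti-involution and left multiplication on cells\<close>

lemma bar_star:
  assumes "l \<in> \<Lambda>'" "S \<in> M' l" "T \<in> M' l"
  shows "star (C' l S T) = C' l T S"
proof (cases l)
  case None
  then show ?thesis using assms star_cell_elem[of "Kr _ _"] by auto
next
  case (Some k)
  then obtain S' T' where "k \<in> \<Lambda>" "S' \<in> M k" "T' \<in> M k" "S = Inl S'" "T = Inl T'"
    using assms by (auto simp: bar_Lambda_def)
  then show ?thesis
    using Some by (simp add: star_incl[OF C_closed C_closed cell.star_C])
qed

text \<open>The coefficients are those of \<open>group_part P\<close> in the given structure. The
  group part of the error is the error in the group algebra, hence lower; its \<open>Kr\<close> part
  is lower because the new index lies below all others.\<close>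

lemma bar_mult_group:
  assumes P: "P \<in> carrier B" and l: "l \<in> \<Lambda>"
  shows "\<exists>r. \<forall>S\<in>M' (Some l). \<forall>T\<in>M' (Some l).
    P \<otimes>\<^bsub>B\<^esub> C' (Some l) S T \<ominus>\<^bsub>B\<^esub> (\<Oplus>\<^bsub>B\<^esub>S'\<in>M' (Some l). r S' S \<odot>\<^bsub>B\<^esub> C' (Some l) S' T)
      \<in> cell_lower B \<Lambda>' po' M' C' (Some l)"
proof -
  obtain r where r: "group_part P \<otimes>\<^bsub>GA\<^esub> C l S T \<ominus>\<^bsub>GA\<^esub> (\<Oplus>\<^bsub>GA\<^esub>S'\<in>M l. r S' S \<odot>\<^bsub>GA\<^esub> C l S' T)
      \<in> cell_lower GA \<Lambda> po M C l" if "S \<in> M l" "T \<in> M l" for S T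
    using cell.mult_C[OF group_part_closed l] by blast
  define Y where "Y = {C' k S T | k S T. k \<in> \<Lambda>' \<and> (k, Some l) \<in> po' \<and> k \<noteq> Some l \<and> S \<in> M' k \<and> T \<in> M' k}"
  define Z where "Z = {C k S T | k S T. k \<in> \<Lambda> \<and> (k, l) \<in> po \<and> k \<noteq> l \<and> S \<in> M k \<and> T \<in> M k}"
  have Z: "Z \<subseteq> carrier GA" using C_closed by (auto simp: Z_def)
  have "Y \<subseteq> (\<lambda>(l, S, T). C' l S T) ` (SIGMA l:\<Lambda>'. M' l \<times> M' l)" by (force simp: Y_def)
  then have Y: "Y \<subseteq> carrier B" using bar_cells_closed unfolding bar_cells_eq by blast
  have ZY: "incl ` Z \<subseteq> Y"
  proof
    fix x assume "x \<in> incl ` Z"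
    then obtain k S T where "k \<in> \<Lambda>" "(k, l) \<in> po" "k \<noteq> l" "S \<in> M k" "T \<in> M k" "x = incl (C k S T)"
      by (auto simp: Z_def)
    then show "x \<in> Y"
      unfolding Y_def by (intro CollectI exI[of _ "Some k"] exI[of _ "Inl S"] exI[of _ "Inl T"])
        (auto simp: bar_Lambda_def bar_po_def)
  qed
  have kr: "kr_elem m \<tau> i j \<in> Y" if "i < m" "j < m" for i j
    unfolding Y_def using that l by (intro CollectI exI[of _ None] exI[of _ "Inr i"] exI[of _ "Inr j"])
      (auto simp: bar_Lambda_def bar_po_def)
  have main: "P \<otimes>\<^bsub>B\<^esub> incl (C l S T) \<ominus>\<^bsub>B\<^esub> (\<Oplus>\<^bsub>B\<^esub>S'\<in>Inl ` M l. r (projl S') S \<odot>\<^bsub>B\<^esub> C' (Some l) S' (Inl T))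
      \<in> lin_span B Y" (is "?P \<in> _") if S: "S \<in> M l" and T: "T \<in> M l" for S T
  proof (rule lin_span_decompose[OF _ Y _ kr])
    have PC: "P \<otimes>\<^bsub>B\<^esub> incl (C l S T) \<in> carrier B" using P S T l by (simp add: incl_closed C_closed)
    have terms: "(\<lambda>S'. r (projl S') S \<odot>\<^bsub>B\<^esub> C' (Some l) S' (Inl T)) \<in> Inl ` M l \<rightarrow> carrier B"
      "(\<lambda>S'. r S' S \<odot>\<^bsub>GA\<^esub> C l S' T) \<in> M l \<rightarrow> carrier GA"
      using T l by (auto simp: B.scalar_simps GA.scalar_simps incl_closed C_closed)
    have fin: "finite (M l)" using cell.finite_M l .
    show closed: "?P \<in> carrier B" using PC terms by (auto intro: B.finsum_closed)
    have "group_part ?P = group_part P \<otimes>\<^bsub>GA\<^esub> C l S T \<ominus>\<^bsub>GA\<^esub> (\<Oplus>\<^bsub>GA\<^esub>S'\<in>M l. r S' S \<odot>\<^bsub>GA\<^esub> C l S' T)"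
      (is "_ = ?g")
    proof
      fix w
      have g: "?g \<in> carrier GA"
        using S T l terms by (intro GA.minus_closed GA.m_closed GA.finsum_closed group_part_closed C_closed)
      show "group_part ?P w = ?g w"
      proof (cases "w \<in> carrier D")
        case True
        have "coord (\<Oplus>\<^bsub>B\<^esub>S'\<in>Inl ` M l. r (projl S') S \<odot>\<^bsub>B\<^esub> C' (Some l) S' (Inl T)) (Grp w)
            = (\<Sum>S'\<in>M l. r S' S * C l S' T w)"
          using fin terms True T l
          by (subst coord_finsum) (auto simp: sum.reindex coord_smult coord_incl incl_closed C_closed
              intro!: sum.cong)
        moreover have "(\<Oplus>\<^bsub>GA\<^esub>S'\<in>M l. r S' S \<odot>\<^bsub>GA\<^esub> C l S' T) w = (\<Sum>S'\<in>M l. r S' S * C l S' T w)"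
          using fin terms by (simp add: GA_finsum GA_smult)
        moreover have "coord (P \<otimes>\<^bsub>B\<^esub> incl (C l S T)) (Grp w) = (group_part P \<otimes>\<^bsub>GA\<^esub> C l S T) w"
          using fun_cong[OF group_part_mult[OF P incl_closed], of "C l S T" w] S T l True
          by (simp add: C_closed group_part_incl) (simp add: group_part_def)
        ultimately show ?thesis
          using True S T l terms PC
          by (simp add: group_part_def coord_minus GA_minus group_part_closed C_closed B.finsum_closed GA.finsum_closed)
      next
        case False
        then show ?thesis using GA_zero_outside[OF g] by (simp add: group_part_def)
      qed
    qed
    then have "group_part ?P \<in> lin_span GA Z"
      using r[OF S T] by (simp add: cell_lower_def Z_def)
    then have "incl (group_part ?P) \<in> lin_span B (incl ` Z)"
      by (rule incl_lin_span[OF _ Z])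
    then show "incl (group_part ?P) \<in> lin_span B Y"
      using lin_span_mono[OF ZY] by blast
  qed
  show ?thesis
  proof (intro exI[of _ "\<lambda>S' S. r (projl S') (projl S)"] ballI)
    fix S T assume "S \<in> M' (Some l)" "T \<in> M' (Some l)"
    then show "P \<otimes>\<^bsub>B\<^esub> C' (Some l) S T \<ominus>\<^bsub>B\<^esub>
        (\<Oplus>\<^bsub>B\<^esub>S'\<in>M' (Some l). r (projl S') (projl S) \<odot>\<^bsub>B\<^esub> C' (Some l) S' T)
        \<in> cell_lower B \<Lambda>' po' M' C' (Some l)"
      using main by (auto simp: cell_lower_def Y_def)
  qed
qed

text \<open>The new index is minimal, so the lower span is zero and the congruence has to be an
  equality. It holds because left multiplication changes the row index only.\<close>

lemma bar_mult_kr: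
  assumes P: "P \<in> carrier B"
  shows "\<exists>r. \<forall>S\<in>M' None. \<forall>T\<in>M' None.
    P \<otimes>\<^bsub>B\<^esub> C' None S T \<ominus>\<^bsub>B\<^esub> (\<Oplus>\<^bsub>B\<^esub>S'\<in>M' None. r S' S \<odot>\<^bsub>B\<^esub> C' None S' T)
      \<in> cell_lower B \<Lambda>' po' M' C' None"
proof -
  have m0: "0 < m" using m_ge by simp
  \<comment> \<open>Column 0 serves as reference, so r cannot depend on the column T. It exists
    because m is positive.\<close>
  define r where "r k i = coord (P \<otimes>\<^bsub>B\<^esub> kr_elem m \<tau> i 0) (Kr k 0)" for k i
  have coord: "coord (P \<otimes>\<^bsub>B\<^esub> kr_elem m \<tau> i j) b
      = (\<Sum>a\<in>cells. (if cmul a (Kr i j) = b then twist a (Kr i j) else 0) * coord P a)"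
    if "i < m" "j < m" for i j b
  proof -
    have "(\<Sum>c\<in>cells. (if cmul a c = b then twist a c else 0) * (coord P a * coord (kr_elem m \<tau> i j) c))
        = (\<Sum>c\<in>cells. if c = Kr i j then (if cmul a c = b then twist a c else 0) * coord P a else 0)" for a
      using that by (intro sum.cong) (auto simp: coord_kr_elem)
    then show ?thesis using that P finite_cells by (simp add: coord_mult)
  qed
  have main: "P \<otimes>\<^bsub>B\<^esub> kr_elem m \<tau> i j
      = (\<Oplus>\<^bsub>B\<^esub>S'\<in>Inr ` {0..<m}. r (projr S') i \<odot>\<^bsub>B\<^esub> C' None S' (Inr j))" (is "?L = ?R")
    if i: "i < m" and j: "j < m" for i j
  proof (rule coord_eqI)
    fix b assume b: "b \<in> cells"
    have terms: "(\<lambda>S'. r (projr S') i \<odot>\<^bsub>B\<^esub> C' None S' (Inr j)) \<in> Inr ` {0..<m} \<rightarrow> carrier B"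
      using j by (auto simp: B.scalar_simps)
    then have "coord ?R b = (\<Sum>k = 0..<m. r k i * coord (kr_elem m \<tau> k j) b)"
      using j by (subst coord_finsum) (auto simp: sum.reindex coord_smult)
    also have "\<dots> = (\<Sum>k = 0..<m. if b = Kr k j then r k i else 0)"
      using j by (intro sum.cong) (auto simp: coord_kr_elem)
    also have "\<dots> = coord ?L b"
    proof (cases b)
      case (Grp w)
      have "cmul a (Kr i j) \<noteq> b" for a using Grp by (cases a) auto
      then show ?thesis using Grp i j by (simp add: coord)
    next
      case (Kr k l)
      \<comment> \<open>Neither the resulting row nor the scalar depends on the column j, so column
        0 gives the same coefficients.\<close>
      have "cmul a (Kr i j) = Kr k l \<longleftrightarrow> l = j \<and> cmul a (Kr i 0) = Kr k 0"
        "twist a (Kr i j) = twist a (Kr i 0)" for a by (cases a; auto)+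
      then have "coord ?L b = (if l = j then r k i else 0)"
        using i j m0 by (simp add: coord r_def Kr cong: if_cong)
      moreover have "(\<Sum>k' = 0..<m. if b = Kr k' j then r k' i else 0) = (if l = j then r k i else 0)"
        using Kr b by auto
      ultimately show ?thesis by simp
    qed
    finally show "coord ?L b = coord ?R b" ..
  qed (use P i j in \<open>auto intro!: B.finsum_closed simp: B.scalar_simps\<close>)
  show ?thesis
  proof (intro exI[of _ "\<lambda>S' S. r (projr S') (projr S)"] ballI)
    fix S T assume "S \<in> M' None" "T \<in> M' None"
    then obtain i j where ij: "S = Inr i" "T = Inr j" "i < m" "j < m" by auto
    then have "P \<otimes>\<^bsub>B\<^esub> C' None S T \<ominus>\<^bsub>B\<^esub>
        (\<Oplus>\<^bsub>B\<^esub>S'\<in>M' None. r (projr S') (projr S) \<odot>\<^bsub>B\<^esub> C' None S' T) = \<zero>\<^bsub>B\<^esub>"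
      using main[of i j, symmetric] P by (simp add: B.minus_eq B.r_neg)
    then show "P \<otimes>\<^bsub>B\<^esub> C' None S T \<ominus>\<^bsub>B\<^esub>
        (\<Oplus>\<^bsub>B\<^esub>S'\<in>M' None. r (projr S') (projr S) \<odot>\<^bsub>B\<^esub> C' None S' T)
        \<in> cell_lower B \<Lambda>' po' M' C' None"
      by (simp add: cell_lower_def B.lin_span_zero)
  qed
qed

lemma bar_cellular: "cellular_structure B \<Lambda>' po' M' C' star"
proof (intro cellular_structure.intro B.complex_algebra_axioms cellular_structure_axioms.intro)
  show "partial_order_on \<Lambda>' po'" by (rule bar_order)
  show "finite (M' l)" if "l \<in> \<Lambda>'" for l
    using that cell.finite_M by (cases l) (auto simp: bar_Lambda_def)
  show "inj_on (\<lambda>(l, S, T). C' l S T) (SIGMA l:\<Lambda>'. M' l \<times> M' l)" by (rule bar_inj)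
  show "lin_basis B ((\<lambda>(l, S, T). C' l S T) ` (SIGMA l:\<Lambda>'. M' l \<times> M' l))"
    unfolding bar_cells_eq by (rule bar_basis)
  show "linear_anti_involution B star" by (rule star_anti_involution)
  show "star (C' l S T) = C' l T S" if "l \<in> \<Lambda>'" "S \<in> M' l" "T \<in> M' l" for l S T
    using that by (rule bar_star)
  show "\<exists>r. \<forall>S\<in>M' l. \<forall>T\<in>M' l.
      P \<otimes>\<^bsub>B\<^esub> C' l S T \<ominus>\<^bsub>B\<^esub> (\<Oplus>\<^bsub>B\<^esub>S'\<in>M' l. r S' S \<odot>\<^bsub>B\<^esub> C' l S' T) \<in> cell_lower B \<Lambda>' po' M' C' l"
    if "P \<in> carrier B" "l \<in> \<Lambda>'" for P l
    using that bar_mult_kr bar_mult_group by (auto simp: bar_Lambda_def)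
qed

end

text \<open>The first two conjuncts justify the descriptions inside the third:
  \<open>kr_elem\<close> takes the element of a genuine singleton, and \<open>brauer_star\<close>
  denotes the unique map with the required values.\<close>

theorem theorem5p3:
  fixes m :: nat and \<tau> :: complex
    and \<Lambda> :: "'l set" and po :: "('l \<times> 'l) set" and M :: "'l \<Rightarrow> 's set"
    and C :: "'l \<Rightarrow> 's \<Rightarrow> 's \<Rightarrow> sgen list set \<Rightarrow> complex"
  assumes "m \<ge> 3" and "odd m"
    and "cellular_structure (group_algebra m) \<Lambda> po M C (inversion m)"
  shows "(\<forall>i<m. \<forall>j<m. is_singleton (kr_elems m \<tau> i j)) \<and>
    (\<exists>!star. is_brauer_star m \<tau> star) \<and>
    cellular_structure (brauer_algebra m \<tau>) (bar_Lambda \<Lambda>) (bar_po \<Lambda> po)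
      (bar_M m M) (bar_C m \<tau> C) (brauer_star m \<tau>)"
proof -
  interpret brauer_cellular m \<tau> \<Lambda> po M C
    by (intro brauer_cellular.intro brauer.intro odd_dihedral.intro assms)
  show ?thesis
    using kr_elems_singleton ex1_brauer_star bar_cellular by (simp add: brauer_star_eq)
qed

end
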